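(* Let $\beta\in(0,1)$, $p\in(0,1)$ and $q=1-p$. As $n\to\infty$ we have $$\sup_{x\in\mathbb{R}}\left|\mathbb{P}\left(a_n^{\circ}(M_n-1)\le x\right)-\left(H_{\beta,q}(x)\right)^{p\,r_n}\right|\to0.$$ In particular, for the subsequence $(k(n))_{n\in\mathbb{N}}$ we get, as $n\to\infty$, $$\sup_{x\in\mathbb{R}}\left|\mathbb{P}\left(a_n(M_{k(n)}-1)\le x\right)-\left(H_{\beta,q}(x)\right)^{p}\right|\to0.$$
   Context: For $\beta,p\in(0,1)$, $q=1-p$, let $(\varepsilon_j)_{j\in\mathbb{Z}}$ be i.i.d. with $\mathbb{P}(\varepsilon_j=0)=p$ and $\mathbb{P}(\varepsilon_j=1-\beta)=q$. Let $X_k=\sum_{j=0}^\infty\beta^j\varepsilon_{k-j}$, $k\in\mathbb{N}_0$, be the strictly stationary solution of the AR(1) recursion $X_{k+1}=\beta X_k+\varepsilon_{k+1}$; its marginal distribution function is denoted $F_{\beta,p}$. $F_{\beta,q}$ denotes the same object with $p$ replaced by $q$. Let $M_n=\max\{X_0,\ldots,X_{n-1}\}$. The function $\nu_{\beta,q}^{\to}:\mathbb{R}\to(0,\infty)$ is the (existing, unique, continuous) $\log(1/\beta)$-periodic function such that $F_{\beta,q}(y)=y^{\log q/\log\beta}\,\nu_{\beta,q}^{\to}(\log y)$ for all $y\in(0,1)$ if $\beta\in(0,\frac12]$, respectively for all $y\in(0,\frac1\beta-1]$ if $\beta\in(\frac12,1)$. Define $$H_{\beta,q}(x)=\exp\left(-(-x)^{\log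 q/\log\beta}\,\nu_{\beta,q}^{\to}(\log(-x))\right)\text{ for }x<0,\qquad H_{\beta,q}(x)=1\text{ for }x\ge0.$$ Let $a_n=\beta^{-n}$ and $k(n)=\lfloor q^{-n}\rfloor$. For $n\ge k(1)$ write $n=k(m_n)r_n$, where $m_n\in\mathbb{N}$ is uniquely determined by $k(m_n)\le n<k(m_n+1)$ and $r_n=n/k(m_n)\ge1$. Set $a_n^{\circ}=a_{m_n}=\beta^{-m_n}$. *)

theory Defs
  imports "HOL-Probability.Probability"
begin

definition ar_process :: "real \<Rightarrow> (int \<Rightarrow> 'a \<Rightarrow> real) \<Rightarrow> nat \<Rightarrow> 'a \<Rightarrow> real" where
  "ar_process \<beta> \<epsilon> k \<omega> = (\<Sum>j. \<beta> ^ j * \<epsilon> (int k - int j) \<omega>)"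

text \<open>The maximum of the first \<open>n\<close> values; only meaningful for \<open>n \<ge> 1\<close>.\<close>

definition ar_max :: "real \<Rightarrow> (int \<Rightarrow> 'a \<Rightarrow> real) \<Rightarrow> nat \<Rightarrow> 'a \<Rightarrow> real" where
  "ar_max \<beta> \<epsilon> n \<omega> = Max ((\<lambda>k. ar_process \<beta> \<epsilon> k \<omega>) ` {..<n})"

definition iid_innovations :: "real \<Rightarrow> real \<Rightarrow> 'a measure \<Rightarrow> (int \<Rightarrow> 'a \<Rightarrow> real) \<Rightarrow> bool" where
  "iid_innovations \<beta> p P \<epsilon> \<longleftrightarrow>
     prob_space.indep_vars P (\<lambda>_. borel) \<epsilon> UNIV \<and>
     (\<forall>j. measure P {\<omega> \<in> space P. \<epsilon> j \<omega> = 0} = p \<and>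
          measure P {\<omega> \<in> space P. \<epsilon> j \<omega> = 1 - \<beta>} = 1 - p)"

text \<open>
  The marginal distribution function depends only on \<open>\<beta>\<close> and \<open>p\<close>, so it is taken on the
  canonical product space. This makes it available for a parameter other than that of the
  process under study.
\<close>

definition innovation_pmf :: "real \<Rightarrow> real \<Rightarrow> real pmf" where
  "innovation_pmf \<beta> p = map_pmf (\<lambda>b. if b then 0 else 1 - \<beta>) (bernoulli_pmf p)"

definition marginal_cdf :: "real \<Rightarrow> real \<Rightarrow> real \<Rightarrow> real" where
  "marginal_cdf \<beta> p =
     cdf (distr (PiM (UNIV :: int set) (\<lambda>_. measure_pmf (innovation_pmf \<beta> p))) borel
       (ar_process \<beta> (\<lambda>j \<omega>. \<omega> j) 0))"

definition nu_domain :: "real \<Rightarrow> real set" where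
  "nu_domain \<beta> = (if \<beta> \<le> 1 / 2 then {0<..<1} else {0<..1 / \<beta> - 1})"

definition nu :: "real \<Rightarrow> real \<Rightarrow> real \<Rightarrow> real" where
  "nu \<beta> q = (THE \<nu>.
     (\<forall>t. \<nu> t > 0) \<and> continuous_on UNIV \<nu> \<and> (\<forall>t. \<nu> (t + ln (1 / \<beta>)) = \<nu> t) \<and>
     (\<forall>y \<in> nu_domain \<beta>. marginal_cdf \<beta> q y = y powr (ln q / ln \<beta>) * \<nu> (ln y)))"

definition H :: "real \<Rightarrow> real \<Rightarrow> real \<Rightarrow> real" where
  "H \<beta> q x = (if x < 0 then exp (- ((- x) powr (ln q / ln \<beta>) * nu \<beta> q (ln (- x)))) else 1)"

definition a_seq :: "real \<Rightarrow> nat \<Rightarrow> real" where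
  "a_seq \<beta> n = 1 / \<beta> ^ n"

definition k_seq :: "real \<Rightarrow> nat \<Rightarrow> nat" where
  "k_seq q n = nat \<lfloor>1 / q ^ n\<rfloor>"

text \<open>
  The following three are only meaningful for \<open>n \<ge> k_seq q 1\<close>, i.e. for all but finitely many \<open>n\<close>.
\<close>

definition m_seq :: "real \<Rightarrow> nat \<Rightarrow> nat" where
  "m_seq q n = (THE m. 1 \<le> m \<and> k_seq q m \<le> n \<and> n < k_seq q (m + 1))"

definition r_seq :: "real \<Rightarrow> nat \<Rightarrow> real" where
  "r_seq q n = real n / real (k_seq q (m_seq q n))"

definition a_circ :: "real \<Rightarrow> real \<Rightarrow> nat \<Rightarrow> real" where
  "a_circ \<beta> q n = a_seq \<beta> (m_seq q n)"

end

theory Submission imports Defs begin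

text \<open>
  Almost surely \<open>X\<^sub>k = 1 - W\<^sub>k\<close>, where the gap process \<open>W\<close> is driven by the complementary
  coin flips, so its marginal distribution function \<open>F\<close> is that for the parameter \<open>q\<close>. The
  equation \<open>F(\<beta> y) = q F(y)\<close> for small \<open>y\<close> extends \<open>F\<close> to a continuous function \<open>G\<close> with
  \<open>G(\<beta> y) = q G(y)\<close> for all \<open>y\<close>, and \<open>H(x) = exp (- G (- x))\<close>.

  A gap below a small level \<open>u\<close> stays below \<open>u\<close> exactly as long as the coin \<open>\<epsilon> = 0\<close> does not
  show, so the exceedances come in runs, each ended by an independent coin of probability \<open>p\<close>.
  This is the origin of the extremal index \<open>p\<close>. Up to the run in progress at time \<open>n\<close>, no
  exceedance means no end of a run. After truncating \<open>W\<close> to \<open>L\<close> summands, the ends of runs are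
  \<open>L\<close>-dependent and two of them within distance \<open>L\<close> are unlikely, so the probability of
  seeing none before time \<open>n\<close> nearly satisfies \<open>f(n + 1) = (1 - \<pi>) f(n)\<close>. With \<open>u = \<beta>\<^sup>m y\<close> and
  \<open>L = 2 m\<close> the error terms vanish uniformly for \<open>y\<close> in compact sets; monotonicity handles the rest.
\<close>

section \<open>Coin flip sequences\<close>

text \<open>Canonical two-sided sequence of independent coins. All estimates are made on this space;
  \<open>measure_coin_process\<close> carries them over to an arbitrary probability space.\<close>

definition bern :: "real \<Rightarrow> (int \<Rightarrow> bool) measure" where
  "bern p = PiM UNIV (\<lambda>_. measure_pmf (bernoulli_pmf p))"

lemma space_bern [simp]: "space (bern p) = UNIV"
  by (simp add: bern_def space_PiM)

lemma sets_bern: "sets (bern p) = sets (PiM UNIV (\<lambda>_. count_space UNIV))"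
  unfolding bern_def by (intro sets_PiM_cong) auto

lemma measurable_bern_component [measurable]: "(\<lambda>b. b i) \<in> measurable (bern p) (count_space UNIV)"
  using measurable_component_singleton[of i UNIV "\<lambda>_. measure_pmf (bernoulli_pmf p)"]
  by (simp add: bern_def)

lemma prob_space_bern: "prob_space (bern p)"
  unfolding bern_def by (intro prob_space_PiM prob_space_measure_pmf)

text \<open>Kept general in the marginal law because it serves twice: for the coins, and for the
  innovations in \<open>marginal_cdf\<close>.\<close>

lemma indep_vars_PiM_pmf:
  fixes D :: "'a pmf"
  shows "prob_space.indep_vars (PiM (UNIV :: 'i set) (\<lambda>_. measure_pmf D)) (\<lambda>_. count_space UNIV) (\<lambda>i f. f i) UNIV"
proof -
  let ?N = "PiM (UNIV :: 'i set) (\<lambda>_. measure_pmf D)"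
  interpret prob_space ?N by (intro prob_space_PiM prob_space_measure_pmf)
  have sets: "sets ?N = sets (PiM UNIV (\<lambda>_. count_space UNIV))"
    by (intro sets_PiM_cong) auto
  have comp: "(\<lambda>f. f i) \<in> measurable ?N (count_space UNIV)" for i
    using measurable_component_singleton[of i UNIV "\<lambda>_. measure_pmf D"] by simp
  have "distr ?N (PiM UNIV (\<lambda>_. count_space UNIV)) (\<lambda>f. \<lambda>i\<in>UNIV. f i) = ?N"
    by (simp add: restrict_def distr_id2 sets)
  moreover have "distr ?N (count_space UNIV) (\<lambda>f. f i) = measure_pmf D" for i
  proof -
    have "distr ?N (count_space UNIV) (\<lambda>f. f i) = distr ?N (measure_pmf D) (\<lambda>f. f i)"
      by (intro distr_cong) auto
    then show ?thesis
      by (subst (asm) distr_PiM_component) (auto intro: prob_space_measure_pmf)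
  qed
  ultimately show ?thesis
    by (subst indep_vars_iff_distr_eq_PiM') (auto simp: comp)
qed

lemma indep_vars_bern: "prob_space.indep_vars (bern p) (\<lambda>_. count_space UNIV) (\<lambda>i b. b i) UNIV"
  unfolding bern_def by (rule indep_vars_PiM_pmf)

text \<open>That a predicate depends only on the coins in \<open>K\<close> is expressed as
  invariance under changes outside \<open>K\<close>. Such a predicate factors through the
  restriction to \<open>K\<close>, and restrictions to disjoint index sets are independent.\<close>

lemma bern_indep:
  assumes [measurable]: "Measurable.pred (bern p) \<phi>" "Measurable.pred (bern p) \<psi>"
    and \<phi>: "\<And>b b'. (\<And>i. i \<in> K \<Longrightarrow> b i = b' i) \<Longrightarrow> \<phi> b = \<phi> b'"
    and \<psi>: "\<And>b b'. (\<And>i. i \<in> K' \<Longrightarrow> b i = b' i) \<Longrightarrow> \<psi> b = \<psi> b'"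
    and K: "K \<inter> K' = {}"
  shows "measure (bern p) {b. \<phi> b \<and> \<psi> b} = measure (bern p) {b. \<phi> b} * measure (bern p) {b. \<psi> b}"
proof -
  interpret prob_space "bern p" by (rule prob_space_bern)
  \<comment> \<open>A restricted sequence is completed by \<open>False\<close> outside
    \<open>K\<close>, so that the predicate can be evaluated on it.\<close>
  define ext :: "int set \<Rightarrow> (int \<Rightarrow> bool) \<Rightarrow> int \<Rightarrow> bool" where
    "ext K b = (\<lambda>i. i \<in> K \<and> b i)" for K b
  let ?N = "\<lambda>K::int set. PiM K (\<lambda>_. count_space (UNIV :: bool set))"
  have ext [measurable]: "ext K \<in> measurable (?N K) (bern p)" for K
  proof -
    have "ext K \<in> measurable (?N K) (PiM UNIV (\<lambda>_. count_space UNIV))"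
    proof (rule measurable_PiM_single')
      fix i :: int
      show "(\<lambda>b. ext K b i) \<in> measurable (?N K) (count_space UNIV)"
        by (cases "i \<in> K") (auto simp: ext_def)
    qed (auto simp: space_PiM)
    then show ?thesis
      by (simp cong: measurable_cong_sets add: sets_bern)
  qed
  let ?R = "\<lambda>K b. restrict (\<lambda>i. b i) K :: int \<Rightarrow> bool"
  have "indep_var (?N K) (?R K) (?N K') (?R K')"
    by (rule indep_var_restrict[OF indep_vars_bern K]) auto
  moreover have "{f \<in> space (?N K). \<phi> (ext K f)} \<in> sets (?N K)" "{f \<in> space (?N K'). \<psi> (ext K' f)} \<in> sets (?N K')"
    by measurable
  ultimately have "prob ((\<lambda>b. (?R K b, ?R K' b)) -` ({f \<in> space (?N K). \<phi> (ext K f)} \<times> {f \<in> space (?N K'). \<psi> (ext K' f)}) \<inter> space (bern p))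
     = prob (?R K -` {f \<in> space (?N K). \<phi> (ext K f)} \<inter> space (bern p))
      * prob (?R K' -` {f \<in> space (?N K'). \<psi> (ext K' f)} \<inter> space (bern p))"
    by (rule indep_varD)
  moreover have "\<phi> (ext K (?R K b)) = \<phi> b" "\<psi> (ext K' (?R K' b)) = \<psi> b" for b
    by (rule \<phi> \<psi>; simp add: ext_def)+
  ultimately show ?thesis
    by (simp add: vimage_def space_PiM)
qed

lemma distr_bern:
  assumes "prob_space M" "prob_space.indep_vars M (\<lambda>_. count_space UNIV) B UNIV"
    and p: "\<And>j. measure M {\<omega> \<in> space M. B j \<omega>} = p"
  shows "distr M (bern p) (\<lambda>\<omega> j. B j \<omega>) = bern p"
proof -
  interpret prob_space M by fact
  have B [measurable]: "B j \<in> measurable M (count_space UNIV)" for j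
    using assms(2) by (auto simp: indep_vars_def)
  have p01: "0 \<le> p" "p \<le> 1"
    using p[of 0] by (auto simp flip: p[of 0])
  have "distr M (count_space UNIV) (B j) = measure_pmf (bernoulli_pmf p)" for j
  proof (rule measure_eqI_countable[of _ UNIV])
    fix c :: bool
    have T: "emeasure M {\<omega> \<in> space M. B j \<omega>} = ennreal p"
      using p[of j] by (simp add: emeasure_eq_measure)
    have "prob {\<omega> \<in> space M. \<not> B j \<omega>} = 1 - prob {\<omega> \<in> space M. B j \<omega>}"
      by (rule prob_neg) measurable
    then have F: "emeasure M {\<omega> \<in> space M. \<not> B j \<omega>} = ennreal (1 - p)"
      using p[of j] by (simp add: emeasure_eq_measure)
    have "B j -` {c} \<inter> space M = {\<omega> \<in> space M. B j \<omega> = c}" by auto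
    then have "emeasure (distr M (count_space UNIV) (B j)) {c} = emeasure M {\<omega> \<in> space M. B j \<omega> = c}"
      by (simp add: emeasure_distr)
    then show "emeasure (distr M (count_space UNIV) (B j)) {c} = emeasure (measure_pmf (bernoulli_pmf p)) {c}"
      using p01 T F by (cases c) (auto simp: emeasure_pmf_single)
  qed auto
  moreover have "distr M (PiM UNIV (\<lambda>_. count_space UNIV)) (\<lambda>x. \<lambda>i\<in>UNIV. B i x)
     = PiM UNIV (\<lambda>i. distr M (count_space UNIV) (B i))"
    using assms(2) B by (subst (asm) indep_vars_iff_distr_eq_PiM') auto
  ultimately have "distr M (PiM UNIV (\<lambda>_. count_space UNIV)) (\<lambda>x i. B i x) = bern p"
    by (simp add: bern_def restrict_def)
  then show ?thesis
    by (metis (no_types, lifting) distr_cong sets_bern)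
qed

text \<open>Independence makes the joint law of the coins the product law, so every event in the
  coins has its canonical probability.\<close>

lemma measure_coin_process:
  assumes "prob_space M" and ind: "prob_space.indep_vars M (\<lambda>_. count_space UNIV) B UNIV"
    and p: "\<And>j. measure M {\<omega> \<in> space M. B j \<omega>} = p"
    and \<phi>: "Measurable.pred (bern p) \<phi>"
  shows "measure M {\<omega> \<in> space M. \<phi> (\<lambda>j. B j \<omega>)} = measure (bern p) {b. \<phi> b}"
proof -
  interpret prob_space M by fact
  have "B j \<in> measurable M (count_space UNIV)" for j
    using ind by (auto simp: indep_vars_def)
  then have "(\<lambda>\<omega> j. B j \<omega>) \<in> measurable M (PiM UNIV (\<lambda>_. count_space UNIV))"
    by (intro measurable_PiM_single') (auto simp: space_PiM)
  then have B: "(\<lambda>\<omega> j. B j \<omega>) \<in> measurable M (bern p)"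
    by (simp cong: measurable_cong_sets add: sets_bern)
  have "measure (bern p) {b. \<phi> b} = measure (distr M (bern p) (\<lambda>\<omega> j. B j \<omega>)) {b. \<phi> b}"
    by (simp add: distr_bern[OF assms(1-3)])
  also have "\<dots> = measure M {\<omega> \<in> space M. \<phi> (\<lambda>j. B j \<omega>)}"
    using \<phi> by (subst measure_distr[OF B]) (auto simp: pred_def intro!: arg_cong[where f = "measure M"])
  finally show ?thesis by simp
qed

lemma bern_shift: "distr (bern p) (bern p) (\<lambda>b j. b (j + k)) = bern p"
  using distr_PiM_reindex[of UNIV "\<lambda>_. measure_pmf (bernoulli_pmf p)" "\<lambda>j. j + k" UNIV]
  by (simp add: bern_def prob_space_measure_pmf restrict_def)

lemma measurable_bern_shift: "(\<lambda>b j. b (j + k)) \<in> measurable (bern p) (bern p)"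
proof -
  have "(\<lambda>b j. b (j + k)) \<in> measurable (bern p) (PiM UNIV (\<lambda>_. count_space UNIV))"
    by (rule measurable_PiM_single') auto
  then show ?thesis
    by (simp cong: measurable_cong_sets add: sets_bern)
qed

text \<open>The source of strict stationarity: all laws at time \<open>k\<close> reduce to those at
  time 0.\<close>

lemma measure_bern_shift:
  assumes "Measurable.pred (bern p) \<phi>"
  shows "measure (bern p) {b. \<phi> (\<lambda>j. b (j + k))} = measure (bern p) {b. \<phi> b}"
proof -
  have "measure (bern p) {b. \<phi> b} = measure (distr (bern p) (bern p) (\<lambda>b j. b (j + k))) {b. \<phi> b}"
    by (simp add: bern_shift)
  also have "\<dots> = measure (bern p) {b. \<phi> (\<lambda>j. b (j + k))}"
    using assms by (subst measure_distr[OF measurable_bern_shift]) (auto simp: pred_def vimage_def)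
  finally show ?thesis by simp
qed

lemma measure_bern_component:
  assumes "0 \<le> p" "p \<le> 1"
  shows "measure (bern p) {b. b i} = p" "measure (bern p) {b. \<not> b i} = 1 - p"
proof -
  interpret prob_space "bern p" by (rule prob_space_bern)
  have "distr (bern p) (measure_pmf (bernoulli_pmf p)) (\<lambda>b. b i) = measure_pmf (bernoulli_pmf p)"
    unfolding bern_def by (rule distr_PiM_component) (auto intro: prob_space_measure_pmf)
  then have "measure (measure_pmf (bernoulli_pmf p)) {True} = measure (distr (bern p) (measure_pmf (bernoulli_pmf p)) (\<lambda>b. b i)) {True}"
    by simp
  also have "\<dots> = measure (bern p) {b. b i}"
    by (subst measure_distr) (auto simp: vimage_def)
  finally show *: "measure (bern p) {b. b i} = p"
    using assms by (simp add: measure_pmf_single)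
  show "measure (bern p) {b. \<not> b i} = 1 - p"
    using prob_neg[of "\<lambda>b. b i"] measurable_bern_component[of i p] * by (simp add: pred_def)
qed

section \<open>The gap process and its marginal distribution\<close>

text \<open>\<open>b j\<close> stands for the event \<open>\<epsilon>\<^sub>j = 0\<close>, and \<open>gap\<close> for \<open>1 - X\<^sub>k\<close>.\<close>

definition gap :: "real \<Rightarrow> (int \<Rightarrow> bool) \<Rightarrow> int \<Rightarrow> real" where
  "gap \<beta> b k = (\<Sum>j. \<beta> ^ j * (if b (k - int j) then 1 - \<beta> else 0))"

definition gap_trunc :: "real \<Rightarrow> nat \<Rightarrow> (int \<Rightarrow> bool) \<Rightarrow> int \<Rightarrow> real" where
  "gap_trunc \<beta> L b k = (\<Sum>j<L. \<beta> ^ j * (if b (k - int j) then 1 - \<beta> else 0))"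

lemma measurable_gap [measurable]: "(\<lambda>b. gap \<beta> b k) \<in> borel_measurable (bern p)"
  unfolding gap_def by measurable

lemma measurable_gap_trunc [measurable]: "(\<lambda>b. gap_trunc \<beta> L b k) \<in> borel_measurable (bern p)"
  unfolding gap_trunc_def by measurable

lemma gap_shift: "gap \<beta> (\<lambda>j. b (j + l)) k = gap \<beta> b (k + l)"
  by (simp add: gap_def algebra_simps)

lemma gap_trunc_shift: "gap_trunc \<beta> L (\<lambda>j. b (j + l)) k = gap_trunc \<beta> L b (k + l)"
  by (simp add: gap_trunc_def algebra_simps)

lemma gap_cong: "(\<And>i. i \<le> k \<Longrightarrow> b i = b' i) \<Longrightarrow> gap \<beta> b k = gap \<beta> b' k"
  by (simp add: gap_def)

text \<open>The finite range of dependence is the purpose of the truncation: events separated by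
  more than this range become independent.\<close>

lemma gap_trunc_cong:
  "(\<And>i. k - int L < i \<Longrightarrow> i \<le> k \<Longrightarrow> b i = b' i) \<Longrightarrow> gap_trunc \<beta> L b k = gap_trunc \<beta> L b' k"
  unfolding gap_trunc_def by (intro sum.cong) auto

locale ar_gap =
  fixes \<beta> p :: real
  assumes \<beta>: "0 < \<beta>" "\<beta> < 1" and p: "0 < p" "p < 1"
begin

sublocale prob_space "bern p"
  by (rule prob_space_bern)

lemma summable_weights: "summable (\<lambda>j. \<beta> ^ j * (1 - \<beta>))"
  using \<beta> by (intro summable_mult2 summable_geometric) auto

lemma summable_gap: "summable (\<lambda>j. \<beta> ^ j * (if b (k - int j) then 1 - \<beta> else 0))"
  using \<beta> by (intro summable_comparison_test'[OF summable_weights]) auto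

lemma gap_nonneg: "0 \<le> gap \<beta> b k"
  unfolding gap_def using \<beta> by (intro suminf_nonneg summable_gap) auto

lemma gap_le_1: "gap \<beta> b k \<le> 1"
proof -
  have "gap \<beta> b k \<le> (\<Sum>j. \<beta> ^ j * (1 - \<beta>))"
    unfolding gap_def using \<beta> by (intro suminf_le summable_gap summable_weights) auto
  also have "\<dots> = 1"
    using \<beta> by (subst suminf_mult2[symmetric]) (auto simp: suminf_geometric)
  finally show ?thesis .
qed

lemma gap_split: "gap \<beta> b k = gap_trunc \<beta> L b k + \<beta> ^ L * gap \<beta> b (k - int L)"
proof -
  have "gap \<beta> b k = (\<Sum>j. \<beta> ^ (j + L) * (if b (k - int (j + L)) then 1 - \<beta> else 0)) + gap_trunc \<beta> L b k"
    unfolding gap_def gap_trunc_def by (rule suminf_split_initial_segment[OF summable_gap])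
  also have "(\<Sum>j. \<beta> ^ (j + L) * (if b (k - int (j + L)) then 1 - \<beta> else 0)) = \<beta> ^ L * gap \<beta> b (k - int L)"
    unfolding gap_def by (subst suminf_mult[OF summable_gap, symmetric]) (auto simp: power_add algebra_simps intro!: suminf_cong)
  finally show ?thesis by simp
qed

lemma gap_step: "gap \<beta> b (k + 1) = \<beta> * gap \<beta> b k + (if b (k + 1) then 1 - \<beta> else 0)"
  using gap_split[of b "k + 1" 1] by (simp add: gap_trunc_def)

lemma gap_trunc_le: "gap_trunc \<beta> L b k \<le> gap \<beta> b k"
  using gap_split[of b k L] gap_nonneg[of b "k - int L"] \<beta> by simp

lemma gap_le_trunc: "gap \<beta> b k \<le> gap_trunc \<beta> L b k + \<beta> ^ L"
  using gap_split[of b k L] gap_le_1[of b "k - int L"] \<beta> by (simp add: mult_le_one mult_left_le)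

text \<open>Used in contrapositive form: a gap below a small level excludes every recent
  coin.\<close>

lemma gap_trunc_ge:
  assumes "b (k - int i)" "i < L"
  shows "\<beta> ^ i * (1 - \<beta>) \<le> gap_trunc \<beta> L b k"
  using member_le_sum[of i "{..<L}" "\<lambda>j. \<beta> ^ j * (if b (k - int j) then 1 - \<beta> else 0)"] assms \<beta>
  by (simp add: gap_trunc_def)

lemma gap_law:
  assumes [measurable]: "Measurable.pred borel S"
  shows "prob {b. S (gap \<beta> b k)} = prob {b. S (gap \<beta> b 0)}"
proof -
  have "prob {b. S (gap \<beta> (\<lambda>j. b (j + k)) 0)} = prob {b. S (gap \<beta> b 0)}"
    by (rule measure_bern_shift[where \<phi> = "\<lambda>b. S (gap \<beta> b 0)"]) measurable
  moreover have "gap \<beta> (\<lambda>j. b (j + k)) 0 = gap \<beta> b k" for b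
    using gap_shift[of \<beta> b k 0] by simp
  ultimately show ?thesis
    by simp
qed

lemma prob_split:
  assumes [measurable]: "Measurable.pred (bern p) \<phi>" "Measurable.pred (bern p) \<psi>"
  shows "prob {b. \<phi> b} = prob {b. \<psi> b \<and> \<phi> b} + prob {b. \<not> \<psi> b \<and> \<phi> b}"
proof -
  have "{b \<in> space (bern p). \<psi> b \<and> \<phi> b} \<in> events" "{b \<in> space (bern p). \<not> \<psi> b \<and> \<phi> b} \<in> events"
    by measurable
  then have "prob ({b. \<psi> b \<and> \<phi> b} \<union> {b. \<not> \<psi> b \<and> \<phi> b}) = prob {b. \<psi> b \<and> \<phi> b} + prob {b. \<not> \<psi> b \<and> \<phi> b}"
    by (intro finite_measure_Union) auto
  moreover have "{b. \<psi> b \<and> \<phi> b} \<union> {b. \<not> \<psi> b \<and> \<phi> b} = {b. \<phi> b}" by auto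
  ultimately show ?thesis by simp
qed

text \<open>The gap at time \<open>k\<close> uses only coins up to \<open>k\<close>. The predicate
  \<open>Q\<close> covers both outcomes of the next coin.\<close>

lemma indep_next:
  assumes [measurable]: "Measurable.pred borel S"
  shows "prob {b. Q (b (k + 1)) \<and> S (gap \<beta> b k)} = prob {b. Q (b (k + 1))} * prob {b. S (gap \<beta> b k)}"
proof (rule bern_indep[where K = "{k + 1}" and K' = "{..k}"
      and \<phi> = "\<lambda>b. Q (b (k + 1))" and \<psi> = "\<lambda>b. S (gap \<beta> b k)"])
  fix b b' :: "int \<Rightarrow> bool" assume "\<And>i. i \<in> {..k} \<Longrightarrow> b i = b' i"
  then have "gap \<beta> b k = gap \<beta> b' k" by (intro gap_cong) auto
  then show "S (gap \<beta> b k) = S (gap \<beta> b' k)" by simp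
next
  show "Measurable.pred (bern p) (\<lambda>b. Q (b (k + 1)))"
    by (rule measurable_compose[OF measurable_bern_component]) simp
  show "Measurable.pred (bern p) (\<lambda>b. S (gap \<beta> b k))"
    by measurable
qed auto

text \<open>Stationarity together with conditioning on the newest coin gives the self-similarity of
  the marginal law. With \<open>S\<close> arbitrary, it yields the recursion for point masses as
  well as that for \<open>F\<close>.\<close>

lemma gap_law_rec:
  assumes [measurable]: "Measurable.pred borel S"
  shows "prob {b. S (gap \<beta> b 0)}
    = (1 - p) * prob {b. S (\<beta> * gap \<beta> b 0)} + p * prob {b. S (\<beta> * gap \<beta> b 0 + (1 - \<beta>))}"
proof -
  have "prob {b. S (gap \<beta> b 0)} = prob {b. S (gap \<beta> b (0 + 1))}"
    by (rule gap_law[OF assms, symmetric])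
  also have "\<dots> = prob {b. b 1 \<and> S (gap \<beta> b (0 + 1))} + prob {b. \<not> b 1 \<and> S (gap \<beta> b (0 + 1))}"
    by (rule prob_split) measurable
  also have "{b. b 1 \<and> S (gap \<beta> b (0 + 1))} = {b. b 1 \<and> S (\<beta> * gap \<beta> b 0 + (1 - \<beta>))}"
    by (subst gap_step) auto
  also have "{b. \<not> b 1 \<and> S (gap \<beta> b (0 + 1))} = {b. \<not> b 1 \<and> S (\<beta> * gap \<beta> b 0)}"
    by (subst gap_step) auto
  also have "prob {b. b 1 \<and> S (\<beta> * gap \<beta> b 0 + (1 - \<beta>))} = prob {b. b 1} * prob {b. S (\<beta> * gap \<beta> b 0 + (1 - \<beta>))}"
    using indep_next[of "\<lambda>x. S (\<beta> * x + (1 - \<beta>))" "\<lambda>x. x" 0] by simp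
  also have "prob {b. \<not> b 1 \<and> S (\<beta> * gap \<beta> b 0)} = prob {b. \<not> b 1} * prob {b. S (\<beta> * gap \<beta> b 0)}"
    using indep_next[of "\<lambda>x. S (\<beta> * x)" Not 0] by simp
  finally show ?thesis
    using p by (simp add: measure_bern_component)
qed

section \<open>Distribution function of the gap: continuity, scaling and positivity\<close>

definition F :: "real \<Rightarrow> real" where
  "F u = prob {b. gap \<beta> b 0 \<le> u}"

text \<open>Any uniform bound on the point masses can be improved by a fixed factor
  \<open>\<theta> < 1\<close>, so all of them vanish. The factor comes from the recursion, in which
  one of the two preimages, at once or after \<open>n\<close> iterations, leaves the interval from 0
  to 1 that carries the law.\<close>

lemma gap_atom: "prob {b. gap \<beta> b 0 = x} = 0"
proof -
  define mass where "mass x = prob {b. gap \<beta> b 0 = x}" for x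
  have rec: "mass x = (1 - p) * mass (x / \<beta>) + p * mass ((x - (1 - \<beta>)) / \<beta>)" for x
    using gap_law_rec[of "\<lambda>y. y = x"] \<beta> by (simp add: mass_def field_simps)
  have out: "mass x = 0" if "x < 0 \<or> x > 1" for x
  proof -
    have "gap \<beta> b 0 \<noteq> x" for b
      using gap_nonneg[of b 0] gap_le_1[of b 0] that by auto
    then show ?thesis by (simp add: mass_def)
  qed
  \<comment> \<open>This choice gives \<open>x / \<beta> ^ n > 1\<close> for every
    \<open>x \<ge> 1 - \<beta>\<close>.\<close>
  obtain n where n: "\<beta> ^ n < 1 - \<beta>"
    using real_arch_pow_inv[of "1 - \<beta>" \<beta>] \<beta> by auto
  define \<theta> where "\<theta> = max (1 - p) (1 - (1 - p) ^ n)"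
  have \<theta>: "0 \<le> \<theta>" "\<theta> < 1"
    using p by (auto simp: \<theta>_def)
  have contract: "mass x \<le> \<theta> * w" if w: "\<And>x. mass x \<le> w" for w x
  proof -
    have w0: "0 \<le> w" using w[of 0] by (simp add: mass_def order_trans[OF measure_nonneg])
    show ?thesis
    proof (cases "x < 1 - \<beta>")
      case True
      then have "mass ((x - (1 - \<beta>)) / \<beta>) = 0"
        using \<beta> by (intro out disjI1) (simp add: divide_neg_pos)
      then have "mass x = (1 - p) * mass (x / \<beta>)" using rec[of x] by simp
      also have "\<dots> \<le> (1 - p) * w" using w p by (intro mult_left_mono) auto
      also have "\<dots> \<le> \<theta> * w" using w0 by (intro mult_right_mono) (auto simp: \<theta>_def)
      finally show ?thesis .
    next
      case False
      \<comment> \<open>Only the branch of a failed coin is iterated; at each stage the other branch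
        is estimated by \<open>w\<close>, and the weights add up to one.\<close>
      have "mass x \<le> (1 - p) ^ k * mass (x / \<beta> ^ k) + (1 - (1 - p) ^ k) * w" for k
      proof (induction k)
        case (Suc k)
        have "mass (x / \<beta> ^ k) \<le> (1 - p) * mass (x / \<beta> ^ Suc k) + p * w"
          using rec[of "x / \<beta> ^ k"] p w[of "(x / \<beta> ^ k - (1 - \<beta>)) / \<beta>"] by (simp add: field_simps)
        then have "(1 - p) ^ k * mass (x / \<beta> ^ k) \<le> (1 - p) ^ k * ((1 - p) * mass (x / \<beta> ^ Suc k) + p * w)"
          using p by (intro mult_left_mono) auto
        with Suc show ?case by (simp add: algebra_simps)
      qed simp
      from this[of n] have "mass x \<le> (1 - p) ^ n * mass (x / \<beta> ^ n) + (1 - (1 - p) ^ n) * w" .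
      moreover have "mass (x / \<beta> ^ n) = 0"
        using False n \<beta> by (intro out disjI2) (simp add: field_simps)
      ultimately have "mass x \<le> (1 - (1 - p) ^ n) * w" by simp
      also have "\<dots> \<le> \<theta> * w" using w0 by (intro mult_right_mono) (auto simp: \<theta>_def)
      finally show ?thesis .
    qed
  qed
  have "mass x \<le> \<theta> ^ k" for x k
    by (induction k arbitrary: x) (auto simp: mass_def contract[unfolded mass_def])
  moreover have "(\<lambda>k. \<theta> ^ k) \<longlonglongrightarrow> 0"
    using \<theta> by (intro LIMSEQ_realpow_zero) auto
  ultimately have "mass x \<le> 0"
    by (intro LIMSEQ_le_const[of _ _ "mass x"]) auto
  then show ?thesis
    using measure_nonneg[of "bern p"] by (simp add: mass_def order_antisym)
qed

text \<open>Since there are no atoms, strict and weak inequalities are interchangeable from here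
  on.\<close>

lemma F_eq_less: "prob {b. gap \<beta> b k < u} = F u"
proof -
  have "F u = prob {b. gap \<beta> b 0 = u \<and> gap \<beta> b 0 \<le> u} + prob {b. gap \<beta> b 0 \<noteq> u \<and> gap \<beta> b 0 \<le> u}"
    unfolding F_def by (rule prob_split) measurable
  also have "{b. gap \<beta> b 0 = u \<and> gap \<beta> b 0 \<le> u} = {b. gap \<beta> b 0 = u}" by auto
  also have "{b. gap \<beta> b 0 \<noteq> u \<and> gap \<beta> b 0 \<le> u} = {b. gap \<beta> b 0 < u}" by auto
  finally show ?thesis
    using gap_law[of "\<lambda>x. x < u" k] by (simp add: gap_atom)
qed

lemma F_rec: "F u = (1 - p) * F (u / \<beta>) + p * F ((u - (1 - \<beta>)) / \<beta>)"
  using gap_law_rec[of "\<lambda>y. y \<le> u"] \<beta> by (simp add: F_def field_simps)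

lemma events_gap_le: "{b. gap \<beta> b k \<le> u} \<in> events"
proof -
  have "{b \<in> space (bern p). gap \<beta> b k \<le> u} \<in> events" by measurable
  then show ?thesis by simp
qed

lemma F_mono: "u \<le> v \<Longrightarrow> F u \<le> F v"
  unfolding F_def by (intro finite_measure_mono events_gap_le) auto

lemma F_nonneg: "0 \<le> F u"
  by (simp add: F_def)

lemma F_ge_1: "1 \<le> u \<Longrightarrow> F u = 1"
  using order_trans[OF gap_le_1] prob_space by (simp add: F_def)

lemma F_le_0: assumes "u \<le> 0" shows "F u = 0"
proof -
  have "\<not> gap \<beta> b 0 < u" for b
    using gap_nonneg[of b 0] assms by simp
  then show ?thesis using F_eq_less[of 0 u] by simp
qed

text \<open>In this range the second preimage in \<open>F_rec\<close> is at most 0, where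
  \<open>F\<close> vanishes. This exact scaling is the origin of the periodic function
  \<open>nu\<close>.\<close>

lemma F_scale:
  assumes "u \<le> 1 / \<beta> - 1" shows "F (\<beta> * u) = (1 - p) * F u"
proof -
  have "F ((\<beta> * u - (1 - \<beta>)) / \<beta>) = 0"
    using assms \<beta> by (intro F_le_0) (simp add: field_simps)
  then show ?thesis using F_rec[of "\<beta> * u"] \<beta> by simp
qed

text \<open>Dropping the second term of \<open>F_rec\<close> repeatedly leads to an argument above
  1, where \<open>F\<close> equals 1, at the cost of a positive factor.\<close>

lemma F_pos: assumes "0 < u" shows "0 < F u"
proof -
  obtain n where n: "\<beta> ^ n < u"
    using real_arch_pow_inv[of u \<beta>] \<beta> assms by auto
  have "(1 - p) ^ k * F (u / \<beta> ^ k) \<le> F u" for k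
  proof (induction k)
    case (Suc k)
    have "(1 - p) * F (u / \<beta> ^ Suc k) \<le> F (u / \<beta> ^ k)"
      using F_rec[of "u / \<beta> ^ k"] p F_nonneg[of "(u / \<beta> ^ k - (1 - \<beta>)) / \<beta>"] by (simp add: field_simps)
    then have "(1 - p) ^ k * ((1 - p) * F (u / \<beta> ^ Suc k)) \<le> (1 - p) ^ k * F (u / \<beta> ^ k)"
      using p by (intro mult_left_mono) auto
    with Suc show ?case by (simp add: algebra_simps)
  qed simp
  from this[of n] have "(1 - p) ^ n \<le> F u"
    using F_ge_1[of "u / \<beta> ^ n"] n \<beta> by (simp add: field_simps)
  then show ?thesis using p by (smt (verit) zero_less_power)
qed

lemma F_cdf: "F = cdf (distr (bern p) borel (\<lambda>b. gap \<beta> b 0))"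
  by (rule ext) (simp add: F_def cdf_def measure_distr vimage_def)

lemma continuous_F: "isCont F u"
proof -
  interpret D: real_distribution "distr (bern p) borel (\<lambda>b. gap \<beta> b 0)"
    by (rule real_distribution_distr) simp
  show ?thesis
    unfolding F_cdf D.isCont_cdf by (simp add: measure_distr vimage_def gap_atom)
qed


section \<open>Identification of the gap with the autoregressive process\<close>

lemma gap_complement: "gap \<beta> (\<lambda>j. \<not> b j) k = 1 - gap \<beta> b k"
proof -
  have "(\<Sum>j. \<beta> ^ j * (1 - \<beta>)) = 1"
    using \<beta> by (subst suminf_mult2[symmetric]) (auto simp: suminf_geometric)
  then have "1 - gap \<beta> b k = (\<Sum>j. \<beta> ^ j * (1 - \<beta>) - \<beta> ^ j * (if b (k - int j) then 1 - \<beta> else 0))"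
    unfolding gap_def by (subst suminf_diff[OF summable_weights summable_gap, symmetric]) simp
  also have "\<dots> = gap \<beta> (\<lambda>j. \<not> b j) k"
    unfolding gap_def by (intro suminf_cong) simp
  finally show ?thesis by simp
qed

lemma ar_process_eq_gap:
  assumes "\<And>j. \<epsilon> j \<omega> = 0 \<or> \<epsilon> j \<omega> = 1 - \<beta>"
  shows "ar_process \<beta> \<epsilon> k \<omega> = gap \<beta> (\<lambda>j. \<epsilon> j \<omega> = 1 - \<beta>) (int k)"
  unfolding ar_process_def gap_def using assms by (intro suminf_cong) auto

text \<open>The two readings of a coin differ by a reflection because the weights sum to 1. Reading
  \<open>True\<close> as the value \<open>1 - \<beta>\<close> serves \<open>marginal_cdf\<close>;
  reading it as the value 0 serves the maximum.\<close>

lemma ar_process_eq_one_minus_gap: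
  assumes "\<And>j. \<epsilon> j \<omega> = 0 \<or> \<epsilon> j \<omega> = 1 - \<beta>"
  shows "ar_process \<beta> \<epsilon> k \<omega> = 1 - gap \<beta> (\<lambda>j. \<epsilon> j \<omega> = 0) (int k)"
proof -
  have "(\<lambda>j. \<epsilon> j \<omega> = 1 - \<beta>) = (\<lambda>j. \<not> \<epsilon> j \<omega> = 0)"
    using assms \<beta> by fastforce
  then show ?thesis
    using ar_process_eq_gap[of \<epsilon> \<omega> k] assms gap_complement by simp
qed

text \<open>With the parameter \<open>1 - p\<close> the value \<open>1 - \<beta>\<close> has
  probability \<open>p\<close>, so the process is itself a gap driven by coins of probability
  \<open>p\<close>. This is why the exchanged parameter describes the law near the upper
  endpoint.\<close>

lemma marginal_cdf_eq_F: "marginal_cdf \<beta> (1 - p) = F"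
proof
  fix u
  let ?D = "innovation_pmf \<beta> (1 - p)"
  let ?N = "PiM (UNIV :: int set) (\<lambda>_. measure_pmf ?D)"
  interpret N: prob_space ?N by (intro prob_space_PiM prob_space_measure_pmf)
  have comp: "(\<lambda>f. f i) \<in> measurable ?N (count_space UNIV)" for i
    using measurable_component_singleton[of i UNIV "\<lambda>_. measure_pmf ?D"] by simp
  have comp' [measurable]: "(\<lambda>f. f i) \<in> borel_measurable ?N" for i
    using measurable_compose[OF comp, of "\<lambda>x. x" borel] by simp
  have set_D: "set_pmf ?D \<subseteq> {0, 1 - \<beta>}"
    by (auto simp: innovation_pmf_def)
  have "AE f in ?N. f j = 0 \<or> f j = 1 - \<beta>" for j :: int
    using set_D by (intro AE_PiM_component) (auto simp: AE_measure_pmf_iff prob_space_measure_pmf)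
  then have AE: "AE f in ?N. \<forall>j. f j = 0 \<or> f j = 1 - \<beta>"
    by (simp add: AE_all_countable)
  have indep: "N.indep_vars (\<lambda>_. count_space UNIV) (\<lambda>i f. f i = 1 - \<beta>) UNIV"
    by (rule N.indep_vars_compose2[OF indep_vars_PiM_pmf]) simp
  have prob: "N.prob {f \<in> space ?N. f j = 1 - \<beta>} = p" for j
  proof -
    have "N.prob {f \<in> space ?N. f j = 1 - \<beta>} = measure (distr ?N (measure_pmf ?D) (\<lambda>f. f j)) {1 - \<beta>}"
      using comp by (subst measure_distr) (auto intro!: arg_cong[where f = N.prob])
    also have "\<dots> = measure (measure_pmf ?D) {1 - \<beta>}"
      by (subst distr_PiM_component) (auto intro: prob_space_measure_pmf)
    also have "\<dots> = measure (bernoulli_pmf (1 - p)) ((\<lambda>b. if b then 0 else 1 - \<beta>) -` {1 - \<beta>})"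
      unfolding innovation_pmf_def by (rule measure_map_pmf)
    also have "(\<lambda>b. if b then 0 else 1 - \<beta>) -` {1 - \<beta>} = {False}"
      using \<beta> by (auto split: if_splits)
    also have "measure (bernoulli_pmf (1 - p)) {False} = p"
      using p by (simp add: measure_pmf_single)
    finally show ?thesis .
  qed
  have meas [measurable]: "ar_process \<beta> (\<lambda>j \<omega>. \<omega> j) 0 \<in> borel_measurable ?N"
    unfolding ar_process_def by measurable
  have [measurable]: "Measurable.pred ?N (\<lambda>f. f j = 1 - \<beta>)" for j
    by measurable
  have [measurable]: "(\<lambda>f. gap \<beta> (\<lambda>j. f j = 1 - \<beta>) 0) \<in> borel_measurable ?N"
    unfolding gap_def by measurable
  have "marginal_cdf \<beta> (1 - p) u = N.prob {f \<in> space ?N. ar_process \<beta> (\<lambda>j \<omega>. \<omega> j) 0 f \<le> u}"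
    unfolding marginal_cdf_def cdf_def
    by (subst measure_distr) (auto intro!: arg_cong[where f = N.prob] meas)
  also have "\<dots> = N.prob {f \<in> space ?N. gap \<beta> (\<lambda>j. f j = 1 - \<beta>) 0 \<le> u}"
  proof (rule N.finite_measure_eq_AE)
    show "AE f in ?N. f \<in> {f \<in> space ?N. ar_process \<beta> (\<lambda>j \<omega>. \<omega> j) 0 f \<le> u}
        \<longleftrightarrow> f \<in> {f \<in> space ?N. gap \<beta> (\<lambda>j. f j = 1 - \<beta>) 0 \<le> u}"
      using AE
    proof eventually_elim
      case (elim f)
      then show ?case
        using ar_process_eq_gap[of "\<lambda>j \<omega>. \<omega> j" f 0] by simp
    qed
  qed measurable
  also have "\<dots> = F u"
    unfolding F_def by (rule measure_coin_process[OF N.prob_space_axioms indep prob]) measurable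
  finally show "marginal_cdf \<beta> (1 - p) u = F u" .
qed

section \<open>The extension \<open>G\<close> of \<open>F\<close> that scales everywhere, and the
  function \<open>nu\<close>\<close>

text \<open>The sequence is eventually constant.\<close>

definition G :: "real \<Rightarrow> real" where
  "G y = lim (\<lambda>n. F (\<beta> ^ n * y) / (1 - p) ^ n)"

text \<open>Once the argument is in the range of \<open>F_scale\<close> it stays there, and each
  further step multiplies numerator and denominator by the same factor.\<close>

lemma G_eq:
  assumes "\<beta> ^ n * y \<le> 1 / \<beta> - 1"
  shows "G y = F (\<beta> ^ n * y) / (1 - p) ^ n"
proof -
  have "\<beta> ^ (k + n) * y \<le> 1 / \<beta> - 1 \<and> F (\<beta> ^ (k + n) * y) = (1 - p) ^ k * F (\<beta> ^ n * y)" for k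
  proof (induction k)
    case (Suc k)
    have "\<beta> * (\<beta> ^ (k + n) * y) \<le> \<beta> * (1 / \<beta> - 1)"
      using Suc \<beta> by (intro mult_left_mono) auto
    also have "\<dots> \<le> 1 * (1 / \<beta> - 1)"
      using \<beta> by (intro mult_right_mono) auto
    finally have "\<beta> ^ (Suc k + n) * y \<le> 1 / \<beta> - 1" by (simp add: mult.assoc)
    moreover have "F (\<beta> ^ (Suc k + n) * y) = (1 - p) * F (\<beta> ^ (k + n) * y)"
      using F_scale[of "\<beta> ^ (k + n) * y"] Suc by (simp add: mult.assoc)
    ultimately show ?case using Suc by simp
  qed (use assms in simp)
  then have "F (\<beta> ^ (k + n) * y) / (1 - p) ^ (k + n) = F (\<beta> ^ n * y) / (1 - p) ^ n" for k
    using p by (simp add: power_add)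
  then have "(\<lambda>k. F (\<beta> ^ (k + n) * y) / (1 - p) ^ (k + n)) \<longlonglongrightarrow> F (\<beta> ^ n * y) / (1 - p) ^ n"
    by simp
  then have "(\<lambda>k. F (\<beta> ^ k * y) / (1 - p) ^ k) \<longlonglongrightarrow> F (\<beta> ^ n * y) / (1 - p) ^ n"
    by (rule LIMSEQ_offset)
  then show ?thesis
    unfolding G_def by (rule limI)
qed

lemma ex_scale: "\<exists>n. \<beta> ^ n * y \<le> 1 / \<beta> - 1"
proof -
  have "(\<lambda>n. \<beta> ^ n * y) \<longlonglongrightarrow> 0 * y"
    using \<beta> by (intro tendsto_intros LIMSEQ_realpow_zero) auto
  moreover have "0 * y < 1 / \<beta> - 1" using \<beta> by simp
  ultimately have "\<forall>\<^sub>F n in sequentially. \<beta> ^ n * y < 1 / \<beta> - 1"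
    by (rule order_tendstoD)
  from eventually_happens'[OF sequentially_bot this] show ?thesis
    using less_imp_le by blast
qed

lemma scale_mono: "\<beta> ^ n * y \<le> 1 / \<beta> - 1 \<Longrightarrow> x \<le> y \<Longrightarrow> \<beta> ^ n * x \<le> 1 / \<beta> - 1"
  using \<beta> by (meson mult_left_mono order_trans zero_le_power less_imp_le)

lemma G_eq_F: "y \<le> 1 / \<beta> - 1 \<Longrightarrow> G y = F y"
  using G_eq[of 0 y] by simp

lemma G_mono: assumes "x \<le> y" shows "G x \<le> G y"
proof -
  obtain n where n: "\<beta> ^ n * y \<le> 1 / \<beta> - 1" using ex_scale by blast
  show ?thesis
    using F_mono[of "\<beta> ^ n * x" "\<beta> ^ n * y"] assms \<beta> p
    by (simp add: G_eq[OF n] G_eq[OF scale_mono[OF n assms]] divide_right_mono mult_left_mono)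
qed

lemma G_nonneg: "0 \<le> G y"
proof -
  obtain n where n: "\<beta> ^ n * y \<le> 1 / \<beta> - 1" using ex_scale by blast
  show ?thesis
    using p by (simp add: G_eq[OF n] F_nonneg)
qed

lemma G_pos: assumes "0 < y" shows "0 < G y"
proof -
  obtain n where n: "\<beta> ^ n * y \<le> 1 / \<beta> - 1" using ex_scale by blast
  show ?thesis
    using p \<beta> assms by (simp add: G_eq[OF n] F_pos)
qed

lemma G_scale: "G (\<beta> * y) = (1 - p) * G y"
proof -
  obtain n where n: "\<beta> ^ n * (\<beta> * y) \<le> 1 / \<beta> - 1" using ex_scale by blast
  moreover have eq: "\<beta> ^ n * (\<beta> * y) = \<beta> ^ Suc n * y" by simp
  ultimately have "\<beta> ^ Suc n * y \<le> 1 / \<beta> - 1" by simp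
  from G_eq[OF this] G_eq[OF n] show ?thesis using p unfolding eq by simp
qed

lemma continuous_G: "isCont G y"
proof -
  \<comment> \<open>The margin 1 lets a single index \<open>n\<close> serve on a whole neighbourhood
    of \<open>y\<close>.\<close>
  obtain n where n: "\<beta> ^ n * (y + 1) \<le> 1 / \<beta> - 1" using ex_scale by blast
  have "\<forall>\<^sub>F x in nhds y. x < y + 1"
    by (rule order_tendstoD(2)[OF filterlim_ident]) simp
  then have "\<forall>\<^sub>F x in nhds y. F (\<beta> ^ n * x) / (1 - p) ^ n = G x"
    by eventually_elim (use G_eq[OF scale_mono[OF n]] in auto)
  moreover have "isCont (\<lambda>x. F (\<beta> ^ n * x) / (1 - p) ^ n) y"
    using p by (intro continuous_intros isCont_o2[OF _ continuous_F]) auto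
  ultimately show ?thesis
    using isCont_cong[of "\<lambda>x. F (\<beta> ^ n * x) / (1 - p) ^ n" G y] by simp
qed

text \<open>Going back along the scaling from the edge \<open>1 / \<beta> - 1\<close> makes
  \<open>G\<close> grow geometrically.\<close>

lemma G_unbounded: "\<exists>Y>0. C \<le> G Y"
proof -
  define y where "y = 1 / \<beta> - 1"
  have y: "0 < y" using \<beta> by (simp add: y_def)
  obtain n where n: "C / G y < (1 / (1 - p)) ^ n"
    using real_arch_pow[of "1 / (1 - p)"] p by auto
  have "\<beta> ^ n * (y / \<beta> ^ n) = y" using \<beta> by simp
  then have "G (y / \<beta> ^ n) = F y / (1 - p) ^ n"
    using G_eq[of n "y / \<beta> ^ n"] by (simp add: y_def)
  moreover have "G y = F y" by (rule G_eq_F) (simp add: y_def)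
  moreover have "C < G y * (1 / (1 - p)) ^ n"
    using n G_pos[OF y] by (simp add: pos_divide_less_eq mult.commute)
  ultimately have "C \<le> G (y / \<beta> ^ n)"
    by (simp add: power_one_over)
  moreover have "0 < y / \<beta> ^ n" using y \<beta> by simp
  ultimately show ?thesis by blast
qed

text \<open>The description in \<open>nu\<close> is shown to have exactly one solution. Since
  \<open>\<beta> powr \<alpha> = 1 - p\<close>, the scaling of \<open>G\<close> becomes periodicity
  on the logarithmic scale; conversely, periodicity moves any \<open>t\<close> into the region where
  the defining equation fixes the value.\<close>

lemma nu_eq: "nu \<beta> (1 - p) t = G (exp t) / exp t powr (ln (1 - p) / ln \<beta>)"
proof -
  define \<alpha> where "\<alpha> = ln (1 - p) / ln \<beta>"
  define \<nu> where "\<nu> t = G (exp t) / exp t powr \<alpha>" for t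
  define good where "good \<mu> \<longleftrightarrow> (\<forall>t. \<mu> t > 0) \<and> continuous_on UNIV \<mu> \<and> (\<forall>t. \<mu> (t + ln (1 / \<beta>)) = \<mu> t) \<and>
     (\<forall>y \<in> nu_domain \<beta>. marginal_cdf \<beta> (1 - p) y = y powr \<alpha> * \<mu> (ln y))" for \<mu>
  have ln\<beta>: "ln (1 / \<beta>) = - ln \<beta>" using \<beta> by (simp add: ln_div)
  have powr_\<beta>: "\<beta> powr \<alpha> = 1 - p"
    using \<beta> p by (simp add: \<alpha>_def powr_def)
  have G_div: "G (y / \<beta>) = G y / (1 - p)" for y
    using G_scale[of "y / \<beta>"] \<beta> p by simp
  have period: "\<nu> (t + ln (1 / \<beta>)) = \<nu> t" for t
  proof -
    have "exp (t + ln (1 / \<beta>)) = exp t / \<beta>" using \<beta> by (simp add: exp_add)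
    then show ?thesis
      using \<beta> p by (simp add: \<nu>_def G_div powr_divide powr_\<beta>)
  qed
  have dom_pos: "0 < y" if "y \<in> nu_domain \<beta>" for y
    using that by (auto simp: nu_domain_def split: if_splits)
  have dom: "G y = F y" if "y \<in> nu_domain \<beta>" for y
  proof (rule G_eq_F)
    \<comment> \<open>Both cases of \<open>nu_domain\<close> lie in the range where \<open>G\<close>
      and \<open>F\<close> agree.\<close>
    have "1 \<le> 1 / \<beta> - 1" if "\<beta> \<le> 1 / 2"
      using that \<beta> by (simp add: field_simps)
    then show "y \<le> 1 / \<beta> - 1"
      using that by (auto simp: nu_domain_def split: if_splits)
  qed
  have "continuous_on UNIV \<nu>"
  proof -
    have "isCont (\<lambda>t. G (exp t)) t" for t
      by (intro isCont_o2[OF _ continuous_G]) auto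
    then have "continuous_on UNIV (\<lambda>t. G (exp t))"
      by (simp add: continuous_at_imp_continuous_on)
    then show ?thesis
      unfolding \<nu>_def by (intro continuous_intros) auto
  qed
  moreover have "F y = y powr \<alpha> * \<nu> (ln y)" if "y \<in> nu_domain \<beta>" for y
    using dom[OF that] dom_pos[OF that] by (simp add: \<nu>_def)
  moreover have "\<nu> t > 0" for t
    by (simp add: \<nu>_def G_pos)
  ultimately have good: "good \<nu>"
    unfolding good_def by (simp add: period marginal_cdf_eq_F)
  have unique: "\<mu> = \<nu>" if \<mu>: "good \<mu>" for \<mu>
  proof
    fix t
    have iter: "f (t + real n * ln (1 / \<beta>)) = f t" if "\<And>t. f (t + ln (1 / \<beta>)) = f t" for f :: "real \<Rightarrow> real" and t n
    proof (induction n)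
      case (Suc n)
      then show ?case using that[of "t + real n * ln (1 / \<beta>)"] by (simp add: algebra_simps)
    qed simp
    \<comment> \<open>Each factor \<open>\<beta>\<close> lowers the logarithm by one period.\<close>
    have "\<exists>n. exp t * \<beta> ^ n \<in> nu_domain \<beta>"
    proof -
      have "(\<lambda>n. exp t * \<beta> ^ n) \<longlonglongrightarrow> exp t * 0"
        using \<beta> by (intro tendsto_intros LIMSEQ_realpow_zero) auto
      moreover have "exp t * 0 < min 1 (1 / \<beta> - 1)" using \<beta> by simp
      ultimately have "\<forall>\<^sub>F n in sequentially. exp t * \<beta> ^ n < min 1 (1 / \<beta> - 1)"
        by (rule order_tendstoD)
      from eventually_happens'[OF sequentially_bot this]
      obtain n where "exp t * \<beta> ^ n < min 1 (1 / \<beta> - 1)" ..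
      then show ?thesis
        using \<beta> by (intro exI[of _ n]) (auto simp: nu_domain_def)
    qed
    then obtain n where n: "exp t * \<beta> ^ n \<in> nu_domain \<beta>" ..
    define y where "y = exp t * \<beta> ^ n"
    have y: "ln y = t - real n * ln (1 / \<beta>)" "0 < y"
      using \<beta> by (auto simp: y_def ln_mult ln_realpow ln\<beta>)
    have "y powr \<alpha> * \<mu> (ln y) = y powr \<alpha> * \<nu> (ln y)"
      using \<mu> good n unfolding good_def y_def by metis
    then have "\<mu> (ln y) = \<nu> (ln y)"
      using y by simp
    moreover have "\<mu> (ln y) = \<mu> t" "\<nu> (ln y) = \<nu> t"
      using iter[of \<mu> "ln y" n] iter[of \<nu> "ln y" n] \<mu> good y(1) unfolding good_def by auto
    ultimately show "\<mu> t = \<nu> t" by simp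
  qed
  have "(THE \<mu>. good \<mu>) = \<nu>"
    by (rule the_equality[of good, OF good unique])
  then have "nu \<beta> (1 - p) = \<nu>"
    unfolding nu_def good_def \<alpha>_def .
  then show ?thesis by (simp add: \<nu>_def \<alpha>_def)
qed

lemma H_eq: "x < 0 \<Longrightarrow> H \<beta> (1 - p) x = exp (- G (- x))"
  by (simp add: H_def nu_eq)

end

section \<open>Ends of exceedance runs\<close>

lemma exp_minus_diff_le:
  fixes a b :: real
  assumes "0 \<le> a" "a \<le> b"
  shows "exp (- a) - exp (- b) \<le> b - a"
proof -
  have "exp (- a) - exp (- b) = exp (- a) * (1 - exp (a - b))"
    by (simp add: algebra_simps flip: exp_add)
  also have "\<dots> \<le> 1 - exp (a - b)"
    using assms by (intro mult_left_le_one_le) auto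
  also have "\<dots> \<le> b - a"
    using exp_ge_add_one_self[of "a - b"] by linarith
  finally show ?thesis .
qed

lemma abs_exp_diff_le:
  fixes a b :: real
  assumes "0 \<le> a" "0 \<le> b"
  shows "\<bar>exp (- a) - exp (- b)\<bar> \<le> \<bar>a - b\<bar>"
  using exp_minus_diff_le[of a b] exp_minus_diff_le[of b a] assms
  by (cases "a \<le> b") auto

text \<open>One factor differs from \<open>exp (- x)\<close> by at most the square of
  \<open>x\<close>. All bases lie between 0 and 1, so the errors of the \<open>n\<close> factors
  merely add up.\<close>

lemma abs_power_exp_diff_le:
  fixes x :: real
  assumes "0 \<le> x" "x \<le> 1"
  shows "\<bar>(1 - x) ^ n - exp (- (real n * x))\<bar> \<le> real n * x\<^sup>2"
proof -
  have "exp (- x) \<le> 1 / (1 + x)"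
    using exp_ge_add_one_self[of x] assms by (simp add: exp_minus field_simps)
  also have "\<dots> \<le> 1 - x + x\<^sup>2"
    using assms by (simp add: field_simps power2_eq_square)
  finally have "\<bar>(1 - x) - exp (- x)\<bar> \<le> x\<^sup>2"
    using exp_ge_add_one_self[of "- x"] by (auto simp: abs_le_iff)
  moreover have "\<bar>(1 - x) ^ n - exp (- x) ^ n\<bar> \<le> real n * \<bar>(1 - x) - exp (- x)\<bar>"
    using norm_power_diff[of "1 - x" "exp (- x)" n] assms by simp
  moreover have "exp (- (real n * x)) = exp (- x) ^ n"
    using exp_of_nat_mult[of n "- x"] by simp
  ultimately show ?thesis
    by (smt (verit) mult_left_mono of_nat_0_le_iff)
qed

text \<open>As \<open>c \<le> 1\<close>, earlier errors are not amplified by later steps.\<close>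

lemma abs_diff_power_le:
  fixes f :: "nat \<Rightarrow> real"
  assumes "f 0 = 1" "0 \<le> c" "c \<le> 1" and step: "\<And>n. \<bar>f (Suc n) - c * f n\<bar> \<le> e"
  shows "\<bar>f n - c ^ n\<bar> \<le> real n * e"
proof (induction n)
  case (Suc n)
  have "\<bar>c * f n - c * c ^ n\<bar> = c * \<bar>f n - c ^ n\<bar>"
    using assms by (simp add: abs_mult flip: right_diff_distrib)
  also have "\<dots> \<le> 1 * (real n * e)"
    using Suc assms by (intro mult_mono) auto
  finally show ?case
    using step[of n] by (simp add: algebra_simps)
qed (use assms in simp)

section \<open>Run ends and their approximate independence\<close>

context ar_gap
begin

lemma prob_le:
  assumes [measurable]: "Measurable.pred (bern p) \<phi>" "Measurable.pred (bern p) \<psi>"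
    and "\<And>b. \<phi> b \<Longrightarrow> \<psi> b"
  shows "prob {b. \<phi> b} \<le> prob {b. \<psi> b}"
proof -
  have "{b \<in> space (bern p). \<psi> b} \<in> events" by measurable
  then show ?thesis
    using assms by (intro finite_measure_mono) auto
qed

lemma prob_le_sum:
  assumes [measurable]: "Measurable.pred (bern p) \<phi>" "Measurable.pred (bern p) \<psi>"
      "\<And>k. Measurable.pred (bern p) (\<xi> k)"
    and "finite I" and sub: "\<And>b. \<phi> b \<Longrightarrow> \<psi> b \<or> (\<exists>k\<in>I. \<xi> k b)"
  shows "prob {b. \<phi> b} \<le> prob {b. \<psi> b} + (\<Sum>k\<in>I. prob {b. \<xi> k b})"
proof -
  have "{b \<in> space (bern p). \<psi> b} \<in> events" "{b \<in> space (bern p). \<xi> k b} \<in> events" for k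
    by measurable
  then have m: "{b. \<psi> b} \<in> events" "{b. \<xi> k b} \<in> events" for k
    by simp_all
  have "prob {b. \<phi> b} \<le> prob ({b. \<psi> b} \<union> (\<Union>k\<in>I. {b. \<xi> k b}))"
    using sub m \<open>finite I\<close> by (intro finite_measure_mono) auto
  also have "\<dots> \<le> prob {b. \<psi> b} + prob (\<Union>k\<in>I. {b. \<xi> k b})"
    using m \<open>finite I\<close> by (intro measure_Un_le) auto
  also have "prob (\<Union>k\<in>I. {b. \<xi> k b}) \<le> (\<Sum>k\<in>I. prob {b. \<xi> k b})"
    using m \<open>finite I\<close> by (intro finite_measure_subadditive_finite) auto
  finally show ?thesis by simp
qed

lemma prob_no_coin: "prob {b. \<forall>i<s. \<not> b (k - int i)} = (1 - p) ^ s"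
proof (induction s)
  case 0
  then show ?case using prob_space by simp
next
  case (Suc s)
  have "{b :: int \<Rightarrow> bool. \<forall>i<Suc s. \<not> b (k - int i)} = {b. \<not> b (k - int s) \<and> (\<forall>i<s. \<not> b (k - int i))}"
    by (auto simp: less_Suc_eq)
  also have "prob \<dots> = prob {b. \<not> b (k - int s)} * prob {b. \<forall>i<s. \<not> b (k - int i)}"
  proof (rule bern_indep[where K = "{k - int s}" and K' = "{k - int s<..k}" and
        \<phi> = "\<lambda>b. \<not> b (k - int s)" and \<psi> = "\<lambda>b. \<forall>i<s. \<not> b (k - int i)"])
    show "Measurable.pred (bern p) (\<lambda>b. \<not> b (k - int s))" by measurable
    show "Measurable.pred (bern p) (\<lambda>b. \<forall>i<s. \<not> b (k - int i))" by measurable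
  qed auto
  finally show ?case
    using p Suc by (simp add: measure_bern_component)
qed

text \<open>A run of exceedances ends when the next coin shows, since that lifts the gap to at least
  \<open>1 - \<beta>\<close>. The truncated gap confines the event to the \<open>L + 1\<close> coins
  up to time \<open>k + 1\<close>.\<close>

definition cluster_end :: "real \<Rightarrow> nat \<Rightarrow> (int \<Rightarrow> bool) \<Rightarrow> nat \<Rightarrow> bool" where
  "cluster_end u L b k \<longleftrightarrow> gap_trunc \<beta> L b (int k) < u \<and> b (int k + 1)"

definition no_cluster :: "real \<Rightarrow> nat \<Rightarrow> nat \<Rightarrow> real" where
  "no_cluster u L n = prob {b. \<forall>k<n. \<not> cluster_end u L b k}"

definition trunc_cdf :: "nat \<Rightarrow> real \<Rightarrow> real" where
  "trunc_cdf L u = prob {b. gap_trunc \<beta> L b 0 < u}"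

text \<open>This is the probability that the maximum of the first \<open>n\<close> values is at most
  \<open>1 - u\<close>.\<close>

definition min_gap_tail :: "nat \<Rightarrow> real \<Rightarrow> real" where
  "min_gap_tail n u = prob {b. \<forall>k<n. u \<le> gap \<beta> b (int k)}"

lemma measurable_cluster_end [measurable]: "Measurable.pred (bern p) (\<lambda>b. cluster_end u L b k)"
  unfolding cluster_end_def by measurable

lemma cluster_end_cong:
  "(\<And>i. int k - int L < i \<Longrightarrow> i \<le> int k + 1 \<Longrightarrow> b i = b' i) \<Longrightarrow> cluster_end u L b k = cluster_end u L b' k"
  unfolding cluster_end_def by (intro arg_cong2[where f = "(\<and>)"] arg_cong2[where f = "(<)"] gap_trunc_cong) auto

lemma trunc_cdf_shift: "prob {b. gap_trunc \<beta> L b k < u} = trunc_cdf L u"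
proof -
  have "prob {b. gap_trunc \<beta> L (\<lambda>j. b (j + k)) 0 < u} = trunc_cdf L u"
    unfolding trunc_cdf_def
    by (rule measure_bern_shift[where \<phi> = "\<lambda>b. gap_trunc \<beta> L b 0 < u"]) measurable
  then show ?thesis
    using gap_trunc_shift[of \<beta> L _ k 0] by simp
qed

text \<open>The coin that ends the run is independent of the gap before it; its probability
  \<open>p\<close> is the extremal index.\<close>

lemma prob_cluster_end: "prob {b. cluster_end u L b k} = p * trunc_cdf L u"
proof -
  have "prob {b. b (int k + 1) \<and> gap_trunc \<beta> L b (int k) < u}
      = prob {b. b (int k + 1)} * prob {b. gap_trunc \<beta> L b (int k) < u}"
  proof (rule bern_indep[where K = "{int k + 1}" and K' = "{..int k}" and
        \<phi> = "\<lambda>b. b (int k + 1)" and \<psi> = "\<lambda>b. gap_trunc \<beta> L b (int k) < u"])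
    fix b b' :: "int \<Rightarrow> bool" assume "\<And>i. i \<in> {..int k} \<Longrightarrow> b i = b' i"
    then have "gap_trunc \<beta> L b (int k) = gap_trunc \<beta> L b' (int k)"
      by (intro gap_trunc_cong) auto
    then show "(gap_trunc \<beta> L b (int k) < u) = (gap_trunc \<beta> L b' (int k) < u)" by simp
  next
    show "Measurable.pred (bern p) (\<lambda>b. gap_trunc \<beta> L b (int k) < u)" by measurable
  qed auto
  then show ?thesis
    using p by (simp add: cluster_end_def conj_commute measure_bern_component trunc_cdf_shift)
qed

lemma F_le_trunc_cdf: "F u \<le> trunc_cdf L u"
  unfolding F_eq_less[of 0, symmetric] trunc_cdf_def
  by (rule prob_le) (measurable, rule le_less_trans[OF gap_trunc_le])

text \<open>Truncation lowers the gap by at most \<open>\<beta> ^ L\<close>.\<close>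

lemma trunc_cdf_le_F: "trunc_cdf L u \<le> F (u + \<beta> ^ L)"
  unfolding F_eq_less[of 0, symmetric] trunc_cdf_def
proof (rule prob_le)
  fix b assume "gap_trunc \<beta> L b 0 < u"
  then show "gap \<beta> b 0 < u + \<beta> ^ L"
    using gap_le_trunc[of b 0 L] by simp
qed measurable

context
  fixes u :: real and s L :: nat
  assumes u: "u \<le> (1 - \<beta>) * \<beta> ^ s" and sL: "s < L"
begin

text \<open>A coin at most \<open>s\<close> steps back would contribute at least
  \<open>(1 - \<beta>) * \<beta> ^ s\<close>, hence at least \<open>u\<close>; by
  \<open>s < L\<close> the truncated gap still registers it.\<close>

lemma no_coin_if_gap_trunc_less:
  assumes "gap_trunc \<beta> L b k < u" "i \<le> s"
  shows "\<not> b (k - int i)"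
proof
  assume "b (k - int i)"
  then have "\<beta> ^ i * (1 - \<beta>) < u"
    using gap_trunc_ge[of b k i L] assms sL by simp
  moreover have "\<beta> ^ s * (1 - \<beta>) \<le> \<beta> ^ i * (1 - \<beta>)"
    using \<beta> assms by (intro mult_right_mono power_decreasing) auto
  ultimately show False using u by (simp add: mult.commute)
qed

lemma trunc_cdf_le: "trunc_cdf L u \<le> (1 - p) ^ Suc s"
  unfolding trunc_cdf_def prob_no_coin[of "Suc s" 0, symmetric]
proof (rule prob_le)
  fix b assume "gap_trunc \<beta> L b 0 < u"
  then show "\<forall>i<Suc s. \<not> b (0 - int i)"
    by (intro allI impI no_coin_if_gap_trunc_less) auto
qed measurable

text \<open>The later end requires the \<open>s + 1\<close> coins up to time \<open>n\<close> to
  fail. If the coin at \<open>k + 1\<close> is among them, the two events exclude each other;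
  otherwise these coins come after the first event and are independent of it.\<close>

lemma prob_two_cluster_ends:
  assumes "k < n"
  shows "prob {b. cluster_end u L b k \<and> cluster_end u L b n} \<le> p * trunc_cdf L u * (1 - p) ^ Suc s"
proof (cases "n \<le> Suc k + s")
  case True
  have "\<not> (cluster_end u L b k \<and> cluster_end u L b n)" for b
  proof
    assume *: "cluster_end u L b k \<and> cluster_end u L b n"
    then have "\<not> b (int n - int (n - Suc k))"
      using True unfolding cluster_end_def by (intro no_coin_if_gap_trunc_less) auto
    moreover have "int n - int (n - Suc k) = int k + 1"
      using assms by simp
    ultimately show False using * unfolding cluster_end_def by metis
  qed
  then have "{b. cluster_end u L b k \<and> cluster_end u L b n} = {}" by blast
  then have "prob {b. cluster_end u L b k \<and> cluster_end u L b n} = 0" by (simp only: measure_empty)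
  also have "0 \<le> p * trunc_cdf L u * (1 - p) ^ Suc s"
    using p by (intro mult_nonneg_nonneg) (auto simp: trunc_cdf_def)
  finally show ?thesis .
next
  case False
  have "prob {b. cluster_end u L b k \<and> cluster_end u L b n}
      \<le> prob {b. cluster_end u L b k \<and> (\<forall>i<Suc s. \<not> b (int n - int i))}"
  proof (rule prob_le)
    fix b assume "cluster_end u L b k \<and> cluster_end u L b n"
    then show "cluster_end u L b k \<and> (\<forall>i<Suc s. \<not> b (int n - int i))"
      unfolding cluster_end_def by (intro conjI allI impI no_coin_if_gap_trunc_less) auto
  qed measurable
  also have "\<dots> = prob {b. cluster_end u L b k} * prob {b. \<forall>i<Suc s. \<not> b (int n - int i)}"
  proof (rule bern_indep[where K = "{..int k + 1}" and K' = "{int n - int s..}"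
        and \<phi> = "\<lambda>b. cluster_end u L b k" and \<psi> = "\<lambda>b. \<forall>i<Suc s. \<not> b (int n - int i)"])
    fix b b' :: "int \<Rightarrow> bool" assume "\<And>i. i \<in> {..int k + 1} \<Longrightarrow> b i = b' i"
    then show "cluster_end u L b k = cluster_end u L b' k"
      by (intro cluster_end_cong) auto
  next
    show "Measurable.pred (bern p) (\<lambda>b. \<forall>i<Suc s. \<not> b (int n - int i))" by measurable
  qed (use False in auto)
  finally show ?thesis
    using prob_no_coin[of "Suc s" "int n"] prob_cluster_end[of u L k] by simp
qed

text \<open>The decrease from \<open>n\<close> to \<open>Suc n\<close> is the probability of a first
  end at \<open>n\<close>. Ignoring the last \<open>L\<close> times makes the past independent of
  that end. The cost is one term for two nearby ends and one for replacing
  \<open>no_cluster u L (n - L)\<close> by \<open>no_cluster u L n\<close>.\<close>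

lemma no_cluster_step:
  defines "\<pi> \<equiv> p * trunc_cdf L u"
  shows "\<bar>no_cluster u L (Suc n) - (1 - \<pi>) * no_cluster u L n\<bar> \<le> real L * \<pi> * (\<pi> + (1 - p) ^ Suc s)"
proof -
  have \<pi>0: "0 \<le> \<pi>" using p by (simp add: \<pi>_def trunc_cdf_def)
  let ?C = "cluster_end u L"
  define D where "D = prob {b. ?C b n \<and> (\<forall>k<n. \<not> ?C b k)}"
  have "no_cluster u L n = D + prob {b. \<not> ?C b n \<and> (\<forall>k<n. \<not> ?C b k)}"
    unfolding no_cluster_def D_def by (rule prob_split) measurable
  also have "{b. \<not> ?C b n \<and> (\<forall>k<n. \<not> ?C b k)} = {b. \<forall>k<Suc n. \<not> ?C b k}"
    by (auto simp: less_Suc_eq)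
  finally have D: "no_cluster u L (Suc n) = no_cluster u L n - D"
    by (simp add: no_cluster_def)
  \<comment> \<open>For \<open>n < L\<close> the natural difference is 0 and the condition on the
    past is void, so the same argument applies.\<close>
  define D' where "D' = prob {b. ?C b n \<and> (\<forall>k<n - L. \<not> ?C b k)}"
  \<comment> \<open>The end at \<open>n\<close> uses coins after \<open>n - L\<close>; an end at
    \<open>k < n - L\<close> uses coins up to \<open>k + 1\<close>, so none after
    \<open>n - L\<close>.\<close>
  have "D' = prob {b. ?C b n} * prob {b. \<forall>k<n - L. \<not> ?C b k}"
    unfolding D'_def
  proof (rule bern_indep[where K = "{int n - int L<..}" and K' = "{..int n - int L}"
        and \<phi> = "\<lambda>b. ?C b n" and \<psi> = "\<lambda>b. \<forall>k<n - L. \<not> ?C b k"])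
    fix b b' :: "int \<Rightarrow> bool" assume "\<And>i. i \<in> {int n - int L<..} \<Longrightarrow> b i = b' i"
    then show "?C b n = ?C b' n"
      by (intro cluster_end_cong) auto
  next
    fix b b' :: "int \<Rightarrow> bool" assume *: "\<And>i. i \<in> {..int n - int L} \<Longrightarrow> b i = b' i"
    have "?C b k = ?C b' k" if "k < n - L" for k
      using that by (intro cluster_end_cong *) auto
    then show "(\<forall>k<n - L. \<not> ?C b k) = (\<forall>k<n - L. \<not> ?C b' k)" by simp
  next
    show "Measurable.pred (bern p) (\<lambda>b. \<forall>k<n - L. \<not> ?C b k)" by measurable
  qed auto
  then have D': "D' = \<pi> * no_cluster u L (n - L)"
    by (simp add: \<pi>_def prob_cluster_end no_cluster_def)
  have card: "card {n - L..<n} \<le> L" by simp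
  have "D \<le> D'"
    unfolding D_def D'_def by (rule prob_le) (measurable, auto)
  have "D' \<le> D + (\<Sum>k\<in>{n - L..<n}. prob {b. ?C b k \<and> ?C b n})"
    unfolding D_def D'_def
  proof (rule prob_le_sum)
    fix b assume "?C b n \<and> (\<forall>k<n - L. \<not> ?C b k)"
    then show "(?C b n \<and> (\<forall>k<n. \<not> ?C b k)) \<or> (\<exists>k\<in>{n - L..<n}. ?C b k \<and> ?C b n)"
      by (meson atLeastLessThan_iff not_less)
  qed (measurable, auto)
  also have "(\<Sum>k\<in>{n - L..<n}. prob {b. ?C b k \<and> ?C b n}) \<le> of_nat (card {n - L..<n}) * (\<pi> * (1 - p) ^ Suc s)"
    unfolding \<pi>_def by (intro sum_bounded_above prob_two_cluster_ends) auto
  also have "\<dots> \<le> real L * (\<pi> * (1 - p) ^ Suc s)"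
    using card \<pi>0 p by (intro mult_right_mono of_nat_mono mult_nonneg_nonneg) auto
  finally have "D' \<le> D + real L * (\<pi> * (1 - p) ^ Suc s)" by simp
  have "no_cluster u L n \<le> no_cluster u L (n - L)"
    unfolding no_cluster_def by (rule prob_le) (measurable, auto)
  have "no_cluster u L (n - L) \<le> no_cluster u L n + (\<Sum>k\<in>{n - L..<n}. prob {b. ?C b k})"
    unfolding no_cluster_def
  proof (rule prob_le_sum)
    fix b assume "\<forall>k<n - L. \<not> ?C b k"
    then show "(\<forall>k<n. \<not> ?C b k) \<or> (\<exists>k\<in>{n - L..<n}. ?C b k)"
      by (meson atLeastLessThan_iff not_less)
  qed (measurable, auto)
  also have "(\<Sum>k\<in>{n - L..<n}. prob {b. ?C b k}) \<le> of_nat (card {n - L..<n}) * \<pi>"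
    unfolding \<pi>_def by (intro sum_bounded_above) (simp add: prob_cluster_end)
  also have "\<dots> \<le> real L * \<pi>"
    using card \<pi>0 by (intro mult_right_mono of_nat_mono) auto
  finally have "no_cluster u L (n - L) \<le> no_cluster u L n + real L * \<pi>" by simp
  then have "D' \<le> \<pi> * no_cluster u L n + real L * \<pi> * \<pi>"
    using \<pi>0 mult_left_mono[of "no_cluster u L (n - L)" "no_cluster u L n + real L * \<pi>" \<pi>]
    by (simp add: D' algebra_simps)
  moreover have "\<pi> * no_cluster u L n \<le> D'"
    using \<pi>0 \<open>no_cluster u L n \<le> no_cluster u L (n - L)\<close> by (simp add: D' mult_left_mono)
  moreover have "0 \<le> real L * \<pi> * \<pi>" "0 \<le> real L * (\<pi> * (1 - p) ^ Suc s)"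
    using \<pi>0 p by auto
  ultimately have "\<bar>\<pi> * no_cluster u L n - D\<bar> \<le> real L * \<pi> * \<pi> + real L * (\<pi> * (1 - p) ^ Suc s)"
    using \<open>D \<le> D'\<close> \<open>D' \<le> D + real L * (\<pi> * (1 - p) ^ Suc s)\<close> by linarith
  then show ?thesis
    by (simp add: D algebra_simps)
qed

text \<open>Without a run end, an exceedance persists until time \<open>n - 1\<close>. Hence the
  only discrepancy is a run still in progress at that time, of probability
  \<open>F u\<close>.\<close>

lemma no_cluster_le:
  assumes "0 < n"
  shows "no_cluster u L n \<le> min_gap_tail n u + F u"
proof -
  have "no_cluster u L n \<le> prob {b. \<forall>k<n. u \<le> gap \<beta> b (int k)}
      + (\<Sum>k\<in>{n - 1}. prob {b. gap \<beta> b (int k) < u})"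
    unfolding no_cluster_def
  proof (rule prob_le_sum)
    fix b assume no: "\<forall>k<n. \<not> cluster_end u L b k"
    have run: "k + j < n \<Longrightarrow> gap \<beta> b (int (k + j)) < u" if k: "gap \<beta> b (int k) < u" for k j
    proof (induction j)
      case 0
      then show ?case using k by simp
    next
      case (Suc j)
      then have less: "gap \<beta> b (int (k + j)) < u" and "\<not> cluster_end u L b (k + j)"
        using no by auto
      \<comment> \<open>The truncated gap is also below \<open>u\<close>, so the absence of a run
        end means that the next coin fails and the gap shrinks.\<close>
      then have "\<not> b (int (k + j) + 1)"
        using le_less_trans[OF gap_trunc_le less] by (simp add: cluster_end_def)
      then have "gap \<beta> b (int (k + j) + 1) = \<beta> * gap \<beta> b (int (k + j))"
        by (subst gap_step) simp
      also have "\<dots> \<le> gap \<beta> b (int (k + j))"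
        using \<beta> by (intro mult_left_le_one_le gap_nonneg) auto
      also note less
      finally show ?case by (simp add: add.commute)
    qed
    show "(\<forall>k<n. u \<le> gap \<beta> b (int k)) \<or> (\<exists>k\<in>{n - 1}. gap \<beta> b (int k) < u)"
    proof (rule disjCI, rule allI, rule impI)
      fix k assume "\<not> (\<exists>k\<in>{n - 1}. gap \<beta> b (int k) < u)" "k < n"
      then show "u \<le> gap \<beta> b (int k)"
        using run[of k "n - 1 - k"] by force
    qed
  qed (measurable, auto)
  then show ?thesis
    by (simp add: min_gap_tail_def F_eq_less)
qed

text \<open>Without exceedances, a run end can only be an artefact of the truncation: the truncated
  gap is below \<open>u\<close> while the full one is not.\<close>

lemma min_gap_tail_le: "min_gap_tail n u \<le> no_cluster u L n + real n * (F (u + \<beta> ^ L) - F u)"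
proof -
  have "min_gap_tail n u \<le> no_cluster u L n
      + (\<Sum>k\<in>{..<n}. prob {b. \<not> gap \<beta> b (int k) < u \<and> gap_trunc \<beta> L b (int k) < u})"
    unfolding no_cluster_def min_gap_tail_def
  proof (rule prob_le_sum)
    fix b assume "\<forall>k<n. u \<le> gap \<beta> b (int k)"
    then show "(\<forall>k<n. \<not> cluster_end u L b k) \<or>
        (\<exists>k\<in>{..<n}. \<not> gap \<beta> b (int k) < u \<and> gap_trunc \<beta> L b (int k) < u)"
      by (auto simp: cluster_end_def not_less)
  next
    show "Measurable.pred (bern p) (\<lambda>b. \<forall>k<n. u \<le> gap \<beta> b (int k))" by measurable
    show "Measurable.pred (bern p) (\<lambda>b. \<forall>k<n. \<not> cluster_end u L b k)" by measurable
    show "Measurable.pred (bern p) (\<lambda>b. \<not> gap \<beta> b (int k) < u \<and> gap_trunc \<beta> L b (int k) < u)" for k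
      by measurable
  qed simp
  also have "(\<Sum>k\<in>{..<n}. prob {b. \<not> gap \<beta> b (int k) < u \<and> gap_trunc \<beta> L b (int k) < u})
      \<le> of_nat (card {..<n}) * (F (u + \<beta> ^ L) - F u)"
  proof (rule sum_bounded_above)
    fix k
    have "trunc_cdf L u = prob {b. gap_trunc \<beta> L b (int k) < u}"
      by (simp add: trunc_cdf_shift)
    also have "\<dots> = prob {b. gap \<beta> b (int k) < u \<and> gap_trunc \<beta> L b (int k) < u}
        + prob {b. \<not> gap \<beta> b (int k) < u \<and> gap_trunc \<beta> L b (int k) < u}"
      by (rule prob_split) measurable
    also have "{b. gap \<beta> b (int k) < u \<and> gap_trunc \<beta> L b (int k) < u} = {b. gap \<beta> b (int k) < u}"
      using le_less_trans[OF gap_trunc_le] by blast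
    finally show "prob {b. \<not> gap \<beta> b (int k) < u \<and> gap_trunc \<beta> L b (int k) < u} \<le> F (u + \<beta> ^ L) - F u"
      using trunc_cdf_le_F[of L u] by (simp add: F_eq_less)
  qed
  finally show ?thesis by simp
qed

text \<open>The chain runs from \<open>min_gap_tail\<close> through \<open>no_cluster\<close>,
  \<open>(1 - \<pi>) ^ n\<close> and \<open>exp (- (real n * \<pi>))\<close> to the target. The
  truncation error is paid twice, in the first and in the last link; the quadratic term collects the
  dependence between run ends and the passage to the exponential.\<close>

lemma min_gap_tail_approx:
  assumes "0 < n"
  shows "\<bar>min_gap_tail n u - exp (- (real n * (p * F u)))\<bar>
    \<le> (1 - p) ^ Suc s + 2 * real n * (F (u + \<beta> ^ L) - F u) + real n * (2 * real L + 1) * ((1 - p) ^ Suc s)\<^sup>2"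
proof -
  define Q where "Q = (1 - p) ^ Suc s"
  define \<pi> where "\<pi> = p * trunc_cdf L u"
  define \<Delta> where "\<Delta> = F (u + \<beta> ^ L) - F u"
  have "trunc_cdf L u \<le> Q"
    unfolding Q_def by (rule trunc_cdf_le)
  then have t: "trunc_cdf L u \<le> Q" "0 \<le> trunc_cdf L u" "trunc_cdf L u \<le> 1"
    by (auto simp: trunc_cdf_def)
  have \<pi>: "0 \<le> \<pi>" "\<pi> \<le> trunc_cdf L u"
    using p t by (auto simp: \<pi>_def mult_left_le_one_le)
  have "0 \<le> \<Delta>" "0 \<le> Q"
    using F_mono[of u "u + \<beta> ^ L"] \<beta> p by (auto simp: \<Delta>_def Q_def)
  have "F u \<le> Q"
    using F_le_trunc_cdf[of u L] t by linarith
  then have "\<bar>min_gap_tail n u - no_cluster u L n\<bar> \<le> Q + real n * \<Delta>"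
    using no_cluster_le[OF assms] min_gap_tail_le[of n] \<open>0 \<le> \<Delta>\<close> \<open>0 \<le> Q\<close>
      mult_nonneg_nonneg[OF of_nat_0_le_iff[of n] \<open>0 \<le> \<Delta>\<close>]
    unfolding \<Delta>_def[symmetric] abs_le_iff by linarith
  moreover have "\<bar>no_cluster u L n - (1 - \<pi>) ^ n\<bar> \<le> real n * (real L * \<pi> * (\<pi> + Q))"
  proof (rule abs_diff_power_le)
    show "no_cluster u L 0 = 1"
      using prob_space by (simp add: no_cluster_def)
    show "\<bar>no_cluster u L (Suc k) - (1 - \<pi>) * no_cluster u L k\<bar> \<le> real L * \<pi> * (\<pi> + Q)" for k
      unfolding \<pi>_def Q_def by (rule no_cluster_step)
  qed (use \<pi> t in auto)
  moreover have "real n * (real L * \<pi> * (\<pi> + Q)) \<le> real n * (real L * Q * (Q + Q))"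
    using \<pi> t by (intro mult_left_mono mult_mono add_mono) auto
  moreover have "\<bar>(1 - \<pi>) ^ n - exp (- (real n * \<pi>))\<bar> \<le> real n * \<pi>\<^sup>2"
    using \<pi> t by (intro abs_power_exp_diff_le) auto
  moreover have "real n * \<pi>\<^sup>2 \<le> real n * Q\<^sup>2"
    using \<pi> t by (intro mult_left_mono power_mono) auto
  moreover have "\<bar>exp (- (real n * \<pi>)) - exp (- (real n * (p * F u)))\<bar> \<le> real n * \<Delta>"
  proof -
    have "\<bar>exp (- (real n * \<pi>)) - exp (- (real n * (p * F u)))\<bar> \<le> \<bar>real n * \<pi> - real n * (p * F u)\<bar>"
      using \<pi> p F_nonneg[of u] by (intro abs_exp_diff_le) auto
    also have "\<dots> = real n * (p * (trunc_cdf L u - F u))"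
      using F_le_trunc_cdf[of u L] p by (simp add: \<pi>_def abs_mult flip: right_diff_distrib)
    also have "\<dots> \<le> real n * (1 * \<Delta>)"
      using F_le_trunc_cdf[of u L] p trunc_cdf_le_F[of L u]
      by (intro mult_left_mono mult_mono) (auto simp: \<Delta>_def)
    finally show ?thesis by simp
  qed
  ultimately have "\<bar>min_gap_tail n u - exp (- (real n * (p * F u)))\<bar>
      \<le> Q + real n * \<Delta> + real n * (real L * Q * (Q + Q)) + real n * Q\<^sup>2 + real n * \<Delta>"
    by linarith
  also have "\<dots> = Q + 2 * real n * \<Delta> + real n * (2 * real L + 1) * Q\<^sup>2"
    by (simp add: algebra_simps power2_eq_square)
  finally show ?thesis
    by (simp add: Q_def \<Delta>_def)
qed

end


section \<open>Uniform convergence\<close>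

lemma G_le_0: "y \<le> 0 \<Longrightarrow> G y = 0"
  using G_eq_F[of y] F_le_0[of y] \<beta> by (simp add: order_trans[of y 0])

lemma min_gap_tail_antimono:
  assumes "u \<le> v" shows "min_gap_tail n v \<le> min_gap_tail n u"
  unfolding min_gap_tail_def
proof (rule prob_le)
  fix b assume "\<forall>k<n. v \<le> gap \<beta> b (int k)"
  then show "\<forall>k<n. u \<le> gap \<beta> b (int k)"
    using assms order_trans by blast
qed measurable

lemma min_gap_tail_nonneg: "0 \<le> min_gap_tail n u"
  by (simp add: min_gap_tail_def)

lemma min_gap_tail_le_0: "u \<le> 0 \<Longrightarrow> min_gap_tail n u = 1"
  using order_trans[OF _ gap_nonneg] prob_space by (simp add: min_gap_tail_def)

text \<open>This is \<open>min_gap_tail_approx\<close> for \<open>u = \<beta> ^ m * y\<close>,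
  \<open>s = m - c\<close> and \<open>L = 2 * m\<close>. The offset \<open>c\<close> absorbs the
  size of \<open>y\<close>, and \<open>0 < m\<close> ensures \<open>s < L\<close>.\<close>

lemma min_gap_tail_scaled:
  assumes "0 < N" "0 < m" "c \<le> m" "0 \<le> y" "y \<le> Y"
    and c: "\<beta> ^ c * Y \<le> 1 - \<beta>" and dom: "\<beta> ^ m * (Y + 1) \<le> 1 / \<beta> - 1"
  defines "A \<equiv> real N * (1 - p) ^ m" and "Z \<equiv> (1 - p) ^ m / (1 - p) ^ c"
  shows "\<bar>min_gap_tail N (\<beta> ^ m * y) - exp (- (p * A * G y))\<bar>
    \<le> Z + 2 * A * (G (y + \<beta> ^ m) - G y) + real N * (4 * real m + 1) * Z\<^sup>2"
proof -
  have Z: "(1 - p) ^ (m - c) = Z"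
    using \<open>c \<le> m\<close> p by (simp add: Z_def power_diff)
  have "\<beta> ^ m * y = \<beta> ^ (m - c) * (\<beta> ^ c * y)"
    using \<open>c \<le> m\<close> by (simp flip: power_add mult.assoc)
  also have "\<dots> \<le> \<beta> ^ (m - c) * (1 - \<beta>)"
    using \<beta> assms by (intro mult_left_mono order_trans[OF _ c]) auto
  finally have u: "\<beta> ^ m * y \<le> (1 - \<beta>) * \<beta> ^ (m - c)"
    by (simp add: mult.commute)
  have \<beta>m: "\<beta> ^ m \<le> 1" using \<beta> by (simp add: power_le_one)
  have F1: "F (\<beta> ^ m * y) = (1 - p) ^ m * G y"
    using G_eq[OF scale_mono[OF dom]] \<open>y \<le> Y\<close> p by simp
  \<comment> \<open>The choice of \<open>L\<close> makes the truncation error, after scaling, a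
    shift by \<open>\<beta> ^ m\<close> in the argument of \<open>G\<close>.\<close>
  have "\<beta> ^ m * y + \<beta> ^ (2 * m) = \<beta> ^ m * (y + \<beta> ^ m)"
    by (simp add: distrib_left mult_2 power_add)
  then have F2: "F (\<beta> ^ m * y + \<beta> ^ (2 * m)) = (1 - p) ^ m * G (y + \<beta> ^ m)"
    using G_eq[OF scale_mono[OF dom, of "y + \<beta> ^ m"]] \<open>y \<le> Y\<close> \<beta>m p by simp
  have "\<bar>min_gap_tail N (\<beta> ^ m * y) - exp (- (real N * (p * F (\<beta> ^ m * y))))\<bar>
      \<le> (1 - p) ^ Suc (m - c) + 2 * real N * (F (\<beta> ^ m * y + \<beta> ^ (2 * m)) - F (\<beta> ^ m * y))
        + real N * (2 * real (2 * m) + 1) * ((1 - p) ^ Suc (m - c))\<^sup>2"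
    using assms by (intro min_gap_tail_approx u) auto
  moreover have QZ: "(1 - p) ^ Suc (m - c) \<le> Z"
    unfolding Z[symmetric] using p by (intro power_decreasing) auto
  moreover have "real N * (2 * real (2 * m) + 1) * ((1 - p) ^ Suc (m - c))\<^sup>2
      \<le> real N * (2 * real (2 * m) + 1) * Z\<^sup>2"
    using QZ p by (intro mult_left_mono power_mono) auto
  ultimately have "\<bar>min_gap_tail N (\<beta> ^ m * y) - exp (- (real N * (p * F (\<beta> ^ m * y))))\<bar>
      \<le> Z + 2 * real N * (F (\<beta> ^ m * y + \<beta> ^ (2 * m)) - F (\<beta> ^ m * y))
        + real N * (2 * real (2 * m) + 1) * Z\<^sup>2"
    by linarith
  then show ?thesis
    unfolding F1 F2 by (simp add: A_def algebra_simps)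
qed

text \<open>On a compact interval the errors are controlled by uniform continuity of
  \<open>G\<close>. Below 0 both functions equal 1; beyond \<open>Y\<close> both are small by
  monotonicity, where \<open>1 \<le> r n\<close> makes \<open>Y\<close> independent of
  \<open>n\<close>.\<close>

lemma min_gap_tail_uniform:
  fixes N m :: "nat \<Rightarrow> nat" and r :: "nat \<Rightarrow> real"
  assumes m: "filterlim m at_top sequentially"
    and N: "\<forall>\<^sub>F n in sequentially. 0 < N n"
    and Nr: "(\<lambda>n. real (N n) * (1 - p) ^ m n - r n) \<longlonglongrightarrow> 0"
    and r: "\<forall>\<^sub>F n in sequentially. 1 \<le> r n \<and> r n \<le> R" and "0 \<le> R" and e: "0 < e"
  shows "\<forall>\<^sub>F n in sequentially. \<forall>y.
    \<bar>min_gap_tail (N n) (\<beta> ^ m n * y) - exp (- (p * r n * G y))\<bar> \<le> e"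
proof -
  obtain Y where Y: "0 < Y" "ln (2 / e) / p \<le> G Y"
    using G_unbounded by blast
  have "exp (- (p * G Y)) \<le> exp (- ln (2 / e))"
    using Y p by (simp add: field_simps)
  then have tail: "exp (- (p * G Y)) \<le> e / 2"
    using e by (simp add: exp_minus)
  obtain c where "\<beta> ^ c < (1 - \<beta>) / Y"
    using real_arch_pow_inv[of "(1 - \<beta>) / Y" \<beta>] \<beta> Y by auto
  then have c: "\<beta> ^ c * Y \<le> 1 - \<beta>"
    using Y by (simp add: field_simps)
  \<comment> \<open>The constant makes the continuity error \<open>2 * (R + 1) * e'\<close> equal to
    \<open>e / 4\<close>.\<close>
  define e' where "e' = e / (8 * (R + 1))"
  have e': "0 < e'" using e \<open>0 \<le> R\<close> by (simp add: e'_def)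
  have "uniformly_continuous_on {0..Y + 1} G"
    by (intro compact_uniformly_continuous continuous_at_imp_continuous_on ballI continuous_G compact_Icc)
  from uniformly_continuous_onE[OF this e'] obtain d where d: "0 < d"
    "\<And>x x'. x \<in> {0..Y + 1} \<Longrightarrow> x' \<in> {0..Y + 1} \<Longrightarrow> dist x' x < d \<Longrightarrow> dist (G x') (G x) < e'"
    by metis
  \<comment> \<open>In the quadratic term, one of the two powers \<open>(1 - p) ^ k\<close> balances
    \<open>N\<close>, leaving a factor of at most \<open>R + 1\<close>; the other outweighs the
    linear factor \<open>k\<close>.\<close>
  define err where "err k = (1 - p) ^ k / (1 - p) ^ c + (R + 1) * (4 * (real k * (1 - p) ^ k) + (1 - p) ^ k) / ((1 - p) ^ c)\<^sup>2" for k
  have q: "(\<lambda>k. (1 - p) ^ k) \<longlonglongrightarrow> 0"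
    using p by (intro LIMSEQ_realpow_zero) auto
  have "(\<lambda>k. real k * (1 - p) ^ k) \<longlonglongrightarrow> 0"
    using p by (intro powser_times_n_limit_0) auto
  then have "err \<longlonglongrightarrow> 0 / (1 - p) ^ c + (R + 1) * (4 * 0 + 0) / ((1 - p) ^ c)\<^sup>2"
    unfolding err_def using p q by (intro tendsto_intros) auto
  then have err: "(\<lambda>n. err (m n) + p * G Y * \<bar>real (N n) * (1 - p) ^ m n - r n\<bar>) \<longlonglongrightarrow> 0 + p * G Y * \<bar>0\<bar>"
    by (intro tendsto_intros Nr filterlim_compose[OF _ m]) simp
  have \<beta>m: "(\<lambda>n. \<beta> ^ m n) \<longlonglongrightarrow> 0"
    using \<beta> by (intro filterlim_compose[OF _ m] LIMSEQ_realpow_zero) auto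
  then have \<beta>mY: "(\<lambda>n. \<beta> ^ m n * (Y + 1)) \<longlonglongrightarrow> 0 * (Y + 1)"
    by (intro tendsto_intros)
  have "\<forall>\<^sub>F n in sequentially. err (m n) + p * G Y * \<bar>real (N n) * (1 - p) ^ m n - r n\<bar> < e / 4"
    using e by (intro order_tendstoD[OF err]) simp
  moreover have "\<forall>\<^sub>F n in sequentially. \<beta> ^ m n < min d 1"
    using d by (intro order_tendstoD[OF \<beta>m]) simp
  moreover have "\<forall>\<^sub>F n in sequentially. \<beta> ^ m n * (Y + 1) < 1 / \<beta> - 1"
    using \<beta> by (intro order_tendstoD[OF \<beta>mY]) simp
  moreover have "\<forall>\<^sub>F n in sequentially. real (N n) * (1 - p) ^ m n - r n < 1"
    by (intro order_tendstoD[OF Nr]) simp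
  moreover have "\<forall>\<^sub>F n in sequentially. max 1 c \<le> m n"
    using m unfolding filterlim_at_top by blast
  ultimately show ?thesis
    using N r
  proof eventually_elim
    case (elim n)
    define A where "A = real (N n) * (1 - p) ^ m n"
    define Z where "Z = (1 - p) ^ m n / (1 - p) ^ c"
    have A: "0 \<le> A" "A \<le> R + 1"
      using elim p by (auto simp: A_def)
    have bounded: "\<bar>min_gap_tail (N n) (\<beta> ^ m n * y) - exp (- (p * r n * G y))\<bar> \<le> e / 2"
      if y: "0 \<le> y" "y \<le> Y" for y
    proof -
      have "\<bar>min_gap_tail (N n) (\<beta> ^ m n * y) - exp (- (p * A * G y))\<bar>
          \<le> Z + 2 * A * (G (y + \<beta> ^ m n) - G y) + real (N n) * (4 * real (m n) + 1) * Z\<^sup>2"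
        unfolding A_def Z_def using elim y c by (intro min_gap_tail_scaled) auto
      moreover have "real (N n) * (4 * real (m n) + 1) * Z\<^sup>2 \<le> err (m n) - Z"
      proof -
        have "real (N n) * (4 * real (m n) + 1) * Z\<^sup>2
            = A * ((4 * (real (m n) * (1 - p) ^ m n) + (1 - p) ^ m n) / ((1 - p) ^ c)\<^sup>2)"
          by (simp add: A_def Z_def power2_eq_square field_simps)
        also have "\<dots> \<le> (R + 1) * ((4 * (real (m n) * (1 - p) ^ m n) + (1 - p) ^ m n) / ((1 - p) ^ c)\<^sup>2)"
          using A p by (intro mult_right_mono) auto
        finally show ?thesis by (simp add: err_def Z_def)
      qed
      moreover have "2 * A * (G (y + \<beta> ^ m n) - G y) \<le> e / 4"
      proof -
        have "dist (G (y + \<beta> ^ m n)) (G y) < e'"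
          using y elim \<beta> by (intro d(2)) (auto simp: dist_real_def)
        then have "G (y + \<beta> ^ m n) - G y \<le> e'" by (simp add: dist_real_def)
        moreover have "0 \<le> G (y + \<beta> ^ m n) - G y"
          using G_mono[of y "y + \<beta> ^ m n"] \<beta> by simp
        ultimately have "2 * A * (G (y + \<beta> ^ m n) - G y) \<le> 2 * (R + 1) * e'"
          using A by (intro mult_mono) auto
        also have "\<dots> = e / 4" using \<open>0 \<le> R\<close> by (simp add: e'_def field_simps)
        finally show ?thesis .
      qed
      moreover have "\<bar>exp (- (p * A * G y)) - exp (- (p * r n * G y))\<bar> \<le> p * G Y * \<bar>A - r n\<bar>"
      proof -
        have "\<bar>exp (- (p * A * G y)) - exp (- (p * r n * G y))\<bar> \<le> \<bar>p * A * G y - p * r n * G y\<bar>"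
          using A p elim G_nonneg by (intro abs_exp_diff_le) auto
        also have "p * A * G y - p * r n * G y = p * G y * (A - r n)"
          by (simp add: algebra_simps)
        also have "\<bar>p * G y * (A - r n)\<bar> = p * G y * \<bar>A - r n\<bar>"
          using p G_nonneg by (simp add: abs_mult)
        also have "\<dots> \<le> p * G Y * \<bar>A - r n\<bar>"
          using p G_mono[OF y(2)] by (intro mult_right_mono mult_left_mono) auto
        finally show ?thesis .
      qed
      moreover have "err (m n) + p * G Y * \<bar>A - r n\<bar> < e / 4"
        using elim by (simp add: A_def)
      ultimately show ?thesis by linarith
    qed
    show ?case
    proof
      fix y :: real
      consider "y < 0" | "0 \<le> y" "y \<le> Y" | "Y < y" by linarith
      then show "\<bar>min_gap_tail (N n) (\<beta> ^ m n * y) - exp (- (p * r n * G y))\<bar> \<le> e"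
      proof cases
        case 1
        then have "\<beta> ^ m n * y \<le> 0" using \<beta> by (simp add: mult_le_0_iff)
        then show ?thesis
          using 1 e by (simp add: min_gap_tail_le_0 G_le_0)
      next
        case 2
        then show ?thesis using bounded[of y] e by linarith
      next
        case 3
        have "p * G Y \<le> p * r n * G Y" "p * G Y \<le> p * r n * G y"
          using elim p G_mono[of Y y] G_nonneg[of Y] 3
          by (auto simp: mult.assoc intro!: mult_left_mono mult_mono[of 1 "r n", simplified])
        then have "exp (- (p * r n * G Y)) \<le> exp (- (p * G Y))" "exp (- (p * r n * G y)) \<le> exp (- (p * G Y))"
          by simp_all
        then have "exp (- (p * r n * G Y)) \<le> e / 2" "exp (- (p * r n * G y)) \<le> e / 2"
          using tail by linarith+
        moreover have "min_gap_tail (N n) (\<beta> ^ m n * y) \<le> min_gap_tail (N n) (\<beta> ^ m n * Y)"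
          using 3 \<beta> by (intro min_gap_tail_antimono mult_left_mono) auto
        moreover have "0 < exp (- (p * r n * G y))" by simp
        moreover have "\<bar>min_gap_tail (N n) (\<beta> ^ m n * Y) - exp (- (p * r n * G Y))\<bar> \<le> e / 2"
          using bounded[of Y] Y by simp
        ultimately show ?thesis
          using min_gap_tail_nonneg[of "N n" "\<beta> ^ m n * y"] unfolding abs_le_iff by linarith
      qed
    qed
  qed
qed


section \<open>Transfer to the maximum of the autoregressive process\<close>

lemma H_eq_exp: "H \<beta> (1 - p) x = exp (- G (- x))"
  using H_eq[of x] G_le_0[of "- x"] by (cases "x < 0") (auto simp: H_def)

text \<open>The two prescribed probabilities add up to 1, so almost surely all innovations take one
  of the two values. On that event the maximum stays below its level exactly when all gaps stay
  above the reflected level.\<close>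

lemma measure_ar_max:
  assumes P: "prob_space P" and iid: "iid_innovations \<beta> p P \<epsilon>" and n: "0 < n"
  shows "measure P {\<omega> \<in> space P. a_seq \<beta> m * (ar_max \<beta> \<epsilon> n \<omega> - 1) \<le> x} = min_gap_tail n (\<beta> ^ m * - x)"
proof -
  interpret P: prob_space P by fact
  have indep: "P.indep_vars (\<lambda>_. borel) \<epsilon> UNIV"
    and p0: "P.prob {\<omega> \<in> space P. \<epsilon> j \<omega> = 0} = p"
    and p1: "P.prob {\<omega> \<in> space P. \<epsilon> j \<omega> = 1 - \<beta>} = 1 - p" for j
    using iid by (auto simp: iid_innovations_def)
  have meas [measurable]: "\<epsilon> j \<in> borel_measurable P" for j
    using indep by (auto simp: P.indep_vars_def)
  have "AE \<omega> in P. \<epsilon> j \<omega> = 0 \<or> \<epsilon> j \<omega> = 1 - \<beta>" for j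
  proof -
    have "P.prob ({\<omega> \<in> space P. \<epsilon> j \<omega> = 0} \<union> {\<omega> \<in> space P. \<epsilon> j \<omega> = 1 - \<beta>}) = p + (1 - p)"
      using \<beta> by (subst P.finite_measure_Union) (auto simp: p0 p1)
    moreover have "{\<omega> \<in> space P. \<epsilon> j \<omega> = 0} \<union> {\<omega> \<in> space P. \<epsilon> j \<omega> = 1 - \<beta>}
        = {\<omega> \<in> space P. \<epsilon> j \<omega> = 0 \<or> \<epsilon> j \<omega> = 1 - \<beta>}"
      by auto
    ultimately show ?thesis
      by (subst P.prob_Collect_eq_1[symmetric]) auto
  qed
  then have AE: "AE \<omega> in P. \<forall>j. \<epsilon> j \<omega> = 0 \<or> \<epsilon> j \<omega> = 1 - \<beta>"
    by (simp add: AE_all_countable)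
  have indep0: "P.indep_vars (\<lambda>_. count_space UNIV) (\<lambda>j \<omega>. \<epsilon> j \<omega> = 0) UNIV"
    by (rule P.indep_vars_compose2[OF indep]) measurable
  have [measurable]: "ar_process \<beta> \<epsilon> k \<in> borel_measurable P" for k
    unfolding ar_process_def by measurable
  have [measurable]: "ar_max \<beta> \<epsilon> n \<in> borel_measurable P"
    unfolding ar_max_def by (intro borel_measurable_Max) auto
  have [measurable]: "(\<lambda>\<omega>. gap \<beta> (\<lambda>j. \<epsilon> j \<omega> = 0) k) \<in> borel_measurable P" for k
    unfolding gap_def by measurable
  have "P.prob {\<omega> \<in> space P. a_seq \<beta> m * (ar_max \<beta> \<epsilon> n \<omega> - 1) \<le> x}
      = P.prob {\<omega> \<in> space P. \<forall>k<n. \<beta> ^ m * - x \<le> gap \<beta> (\<lambda>j. \<epsilon> j \<omega> = 0) (int k)}"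
  proof (rule P.finite_measure_eq_AE)
    show "AE \<omega> in P. \<omega> \<in> {\<omega> \<in> space P. a_seq \<beta> m * (ar_max \<beta> \<epsilon> n \<omega> - 1) \<le> x}
      \<longleftrightarrow> \<omega> \<in> {\<omega> \<in> space P. \<forall>k<n. \<beta> ^ m * - x \<le> gap \<beta> (\<lambda>j. \<epsilon> j \<omega> = 0) (int k)}"
      using AE
    proof eventually_elim
      case (elim \<omega>)
      have "a_seq \<beta> m * (ar_max \<beta> \<epsilon> n \<omega> - 1) \<le> x \<longleftrightarrow> ar_max \<beta> \<epsilon> n \<omega> \<le> 1 + \<beta> ^ m * x"
        using \<beta> by (auto simp: a_seq_def field_simps)
      also have "\<dots> \<longleftrightarrow> (\<forall>k<n. ar_process \<beta> \<epsilon> k \<omega> \<le> 1 + \<beta> ^ m * x)"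
        unfolding ar_max_def using n by (subst Max_le_iff) auto
      also have "\<dots> \<longleftrightarrow> (\<forall>k<n. \<beta> ^ m * - x \<le> gap \<beta> (\<lambda>j. \<epsilon> j \<omega> = 0) (int k))"
        using elim by (subst ar_process_eq_one_minus_gap) auto
      finally show ?case by simp
    qed
  qed measurable
  also have "\<dots> = min_gap_tail n (\<beta> ^ m * - x)"
    unfolding min_gap_tail_def
    by (rule measure_coin_process[OF P indep0 p0, of "\<lambda>b. \<forall>k<n. \<beta> ^ m * - x \<le> gap \<beta> b (int k)"]) measurable
  finally show ?thesis .
qed

text \<open>Common form of both assertions, to be used with \<open>N n = n\<close>,
  \<open>m = m_seq q\<close>, \<open>r = r_seq q\<close>, and with \<open>N = k_seq q\<close>,
  \<open>m n = n\<close>, \<open>r n = 1\<close>.\<close>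

lemma ar_max_uniform_limit:
  fixes N m :: "nat \<Rightarrow> nat" and r :: "nat \<Rightarrow> real"
  assumes P: "prob_space P" and iid: "iid_innovations \<beta> p P \<epsilon>"
    and m: "filterlim m at_top sequentially"
    and N: "\<forall>\<^sub>F n in sequentially. 0 < N n"
    and Nr: "(\<lambda>n. real (N n) * (1 - p) ^ m n - r n) \<longlonglongrightarrow> 0"
    and r: "\<forall>\<^sub>F n in sequentially. 1 \<le> r n \<and> r n \<le> R" and R: "0 \<le> R"
  shows "(\<lambda>n. SUP x. \<bar>measure P {\<omega> \<in> space P. a_seq \<beta> (m n) * (ar_max \<beta> \<epsilon> (N n) \<omega> - 1) \<le> x}
    - H \<beta> (1 - p) x powr (p * r n)\<bar>) \<longlonglongrightarrow> 0"
proof (rule tendstoI)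
  fix e :: real assume e: "0 < e"
  then have "\<forall>\<^sub>F n in sequentially. \<forall>y.
      \<bar>min_gap_tail (N n) (\<beta> ^ m n * y) - exp (- (p * r n * G y))\<bar> \<le> e / 2"
    by (intro min_gap_tail_uniform[OF m N Nr r R]) simp
  then show "\<forall>\<^sub>F n in sequentially. dist (SUP x.
      \<bar>measure P {\<omega> \<in> space P. a_seq \<beta> (m n) * (ar_max \<beta> \<epsilon> (N n) \<omega> - 1) \<le> x}
        - H \<beta> (1 - p) x powr (p * r n)\<bar>) 0 < e"
    using N
  proof eventually_elim
    case (elim n)
    define D where "D x = \<bar>measure P {\<omega> \<in> space P. a_seq \<beta> (m n) * (ar_max \<beta> \<epsilon> (N n) \<omega> - 1) \<le> x}
        - H \<beta> (1 - p) x powr (p * r n)\<bar>" for x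
    have D: "D x \<le> e / 2" for x
    proof -
      have "H \<beta> (1 - p) x powr (p * r n) = exp (- (p * r n * G (- x)))"
        by (simp add: H_eq_exp powr_def)
      then show ?thesis
        using elim(1)[rule_format, of "- x"] measure_ar_max[OF P iid elim(2), of "m n" x]
        by (simp add: D_def)
    qed
    have "(SUP x. D x) \<le> e / 2"
      by (intro cSUP_least D) simp
    \<comment> \<open>The lower bound on the supremum rests on boundedness of \<open>D\<close>,
      which the uniform estimate provides.\<close>
    moreover have "D 0 \<le> (SUP x. D x)"
      by (intro cSUP_upper bdd_aboveI2[where M = "e / 2"] D) simp
    moreover have "0 \<le> D 0" by (simp add: D_def)
    ultimately show ?case
      using e by (simp add: D_def dist_real_def)
  qed
qed

end

section \<open>The normalizing sequences\<close>

lemma k_seq_bounds: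
  assumes "0 < q" "q < 1"
  shows "1 \<le> k_seq q m" "real (k_seq q m) \<le> 1 / q ^ m" "1 / q ^ m < real (k_seq q m) + 1"
proof -
  have "1 \<le> 1 / q ^ m"
    using assms by (simp add: power_le_one)
  then have *: "1 \<le> \<lfloor>1 / q ^ m\<rfloor>" by simp
  then have "nat 1 \<le> nat \<lfloor>1 / q ^ m\<rfloor>" by (rule nat_mono)
  then show "1 \<le> k_seq q m"
    by (simp only: k_seq_def nat_1 One_nat_def)
  have "real (k_seq q m) = of_int \<lfloor>1 / q ^ m\<rfloor>"
    unfolding k_seq_def using * by (intro of_nat_nat) linarith
  then show "real (k_seq q m) \<le> 1 / q ^ m" "1 / q ^ m < real (k_seq q m) + 1"
    by linarith+
qed

lemma k_seq_mono:
  assumes "0 < q" "q < 1" "m \<le> m'"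
  shows "k_seq q m \<le> k_seq q m'"
proof -
  have "1 / q ^ m \<le> 1 / q ^ m'"
    using assms by (intro divide_left_mono power_decreasing) auto
  then show ?thesis
    unfolding k_seq_def by (intro nat_mono floor_mono)
qed

lemma k_seq_mult_power:
  assumes "0 < q" "q < 1"
  shows "(\<lambda>m. real (k_seq q m) * q ^ m) \<longlonglongrightarrow> 1"
proof (rule tendsto_sandwich)
  show "\<forall>\<^sub>F m in sequentially. 1 - q ^ m \<le> real (k_seq q m) * q ^ m"
    using k_seq_bounds(3)[OF assms] assms by (intro always_eventually allI less_imp_le) (simp add: field_simps)
  show "\<forall>\<^sub>F m in sequentially. real (k_seq q m) * q ^ m \<le> 1"
    using k_seq_bounds(2)[OF assms] assms by (intro always_eventually allI) (simp add: field_simps)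
  have "(\<lambda>m. 1 - q ^ m) \<longlonglongrightarrow> 1 - 0"
    using assms by (intro tendsto_intros LIMSEQ_realpow_zero) auto
  then show "(\<lambda>m. 1 - q ^ m) \<longlonglongrightarrow> 1" by simp
qed simp

lemma m_seq_bounds:
  assumes q: "0 < q" "q < 1" and n: "k_seq q 1 \<le> n"
  shows "1 \<le> m_seq q n \<and> k_seq q (m_seq q n) \<le> n \<and> n < k_seq q (m_seq q n + 1)"
  unfolding m_seq_def
proof (rule theI')
  \<comment> \<open>The least such index cannot be 0 because \<open>k_seq q 1 \<le> n\<close>;
    minimality then gives the lower bound on \<open>n\<close>.\<close>
  define m where "m = (LEAST m. n < k_seq q (m + 1))"
  obtain j where j: "real n + 1 < (1 / q) ^ j"
    using real_arch_pow[of "1 / q"] q by auto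
  have "n < k_seq q j"
    using k_seq_bounds(3)[OF q, of j] j by (simp add: power_one_over)
  then have "n < k_seq q (j + 1)"
    using k_seq_mono[OF q, of j "j + 1"] by linarith
  then have m: "n < k_seq q (m + 1)"
    unfolding m_def by (rule LeastI)
  have "m \<noteq> 0" using m n by (intro notI) simp
  then obtain i where i: "m = Suc i" by (cases m) auto
  have "\<not> n < k_seq q (i + 1)"
    using not_less_Least[of i "\<lambda>m. n < k_seq q (m + 1)"] i by (simp add: m_def)
  then have "1 \<le> m \<and> k_seq q m \<le> n \<and> n < k_seq q (m + 1)"
    using m i by simp
  \<comment> \<open>Monotonicity makes the intervals between consecutive values of
    \<open>k_seq\<close> disjoint.\<close>
  moreover have "m' = m''"
    if "1 \<le> m' \<and> k_seq q m' \<le> n \<and> n < k_seq q (m' + 1)" "1 \<le> m'' \<and> k_seq q m'' \<le> n \<and> n < k_seq q (m'' + 1)" for m' m''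
    using that k_seq_mono[OF q, of "m' + 1" m''] k_seq_mono[OF q, of "m'' + 1" m'] by linarith
  ultimately show "\<exists>!m. 1 \<le> m \<and> k_seq q m \<le> n \<and> n < k_seq q (m + 1)"
    by blast
qed

lemma filterlim_m_seq:
  assumes q: "0 < q" "q < 1"
  shows "filterlim (m_seq q) at_top sequentially"
  unfolding filterlim_at_top
proof
  fix M
  have "M \<le> m_seq q n" if "max (k_seq q 1) (k_seq q M) \<le> n" for n
    using m_seq_bounds[OF q, of n] k_seq_mono[OF q, of "m_seq q n + 1" M] that by linarith
  then show "\<forall>\<^sub>F n in sequentially. M \<le> m_seq q n"
    using eventually_ge_at_top by (rule eventually_mono[rotated])
qed

text \<open>One step of the index costs a factor \<open>1 / q\<close>, and rounding down costs at
  most a factor 2 because \<open>k_seq\<close> is at least 1.\<close>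

lemma r_seq_bounds:
  assumes q: "0 < q" "q < 1" and n: "k_seq q 1 \<le> n"
  shows "1 \<le> r_seq q n" "r_seq q n \<le> 2 / q"
proof -
  define m where "m = m_seq q n"
  have m: "k_seq q m \<le> n" "n < k_seq q (m + 1)"
    using m_seq_bounds[OF q n] by (auto simp: m_def)
  have k: "1 \<le> real (k_seq q m)" using k_seq_bounds(1)[OF q, of m] by simp
  show "1 \<le> r_seq q n"
    using m k by (simp add: r_seq_def flip: m_def)
  have "real n \<le> 1 / q ^ (m + 1)"
    using m k_seq_bounds(2)[OF q, of "m + 1"] by linarith
  also have "\<dots> = (1 / q) * (1 / q ^ m)" by simp
  also have "\<dots> \<le> (1 / q) * (2 * real (k_seq q m))"
    using k_seq_bounds(3)[OF q, of m] k q by (intro mult_left_mono) auto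
  finally show "r_seq q n \<le> 2 / q"
    using k by (simp add: r_seq_def pos_divide_le_eq flip: m_def)
qed

theorem corollary4p4:
  fixes \<beta> p q :: real and P :: "'a measure" and \<epsilon> :: "int \<Rightarrow> 'a \<Rightarrow> real"
  assumes "0 < \<beta>" "\<beta> < 1" and "0 < p" "p < 1" and "q = 1 - p"
    and "prob_space P"
    and "iid_innovations \<beta> p P \<epsilon>"
  shows "(\<lambda>n. SUP x::real.
           \<bar>measure P {\<omega> \<in> space P. a_circ \<beta> q n * (ar_max \<beta> \<epsilon> n \<omega> - 1) \<le> x}
             - H \<beta> q x powr (p * r_seq q n)\<bar>) \<longlonglongrightarrow> 0
       \<and> (\<lambda>n. SUP x::real.
           \<bar>measure P {\<omega> \<in> space P. a_seq \<beta> n * (ar_max \<beta> \<epsilon> (k_seq q n) \<omega> - 1) \<le> x}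
             - H \<beta> q x powr p\<bar>) \<longlonglongrightarrow> 0"
proof -
  interpret ar_gap \<beta> p using assms by unfold_locales
  have q: "0 < q" "q < 1" using assms by auto
  have k: "(\<lambda>m. real (k_seq q m) * q ^ m - 1) \<longlonglongrightarrow> 0"
    using tendsto_diff[OF k_seq_mult_power[OF q] tendsto_const[of 1]] by simp
  have large: "\<forall>\<^sub>F n in sequentially. k_seq q 1 \<le> n"
    by (rule eventually_ge_at_top)
  have r: "\<forall>\<^sub>F n in sequentially. 1 \<le> r_seq q n \<and> r_seq q n \<le> 2 / q"
    using large by eventually_elim (simp add: r_seq_bounds[OF q])
  \<comment> \<open>The difference is \<open>r_seq q n\<close> times the rounding error of
    \<open>k_seq\<close> at \<open>m_seq q n\<close>: a bounded factor times one that tends to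
    0.\<close>
  have "(\<lambda>n. real n * q ^ m_seq q n - r_seq q n) \<longlonglongrightarrow> 0"
  proof (rule Lim_null_comparison)
    show "\<forall>\<^sub>F n in sequentially. norm (real n * q ^ m_seq q n - r_seq q n)
        \<le> 2 / q * \<bar>real (k_seq q (m_seq q n)) * q ^ m_seq q n - 1\<bar>"
      using r
    proof eventually_elim
      case (elim n)
      have "0 < real (k_seq q (m_seq q n))"
        using k_seq_bounds(1)[OF q, of "m_seq q n"] by simp
      then have "real n * q ^ m_seq q n - r_seq q n
          = r_seq q n * (real (k_seq q (m_seq q n)) * q ^ m_seq q n - 1)"
        by (simp add: r_seq_def field_simps)
      then show ?case
        using elim mult_right_mono[of "r_seq q n" "2 / q" "\<bar>real (k_seq q (m_seq q n)) * q ^ m_seq q n - 1\<bar>"]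
        by (simp add: abs_mult)
    qed
    have "(\<lambda>n. 2 / q * \<bar>real (k_seq q (m_seq q n)) * q ^ m_seq q n - 1\<bar>) \<longlonglongrightarrow> 2 / q * \<bar>0\<bar>"
      by (intro tendsto_intros filterlim_compose[OF k filterlim_m_seq[OF q]])
    then show "(\<lambda>n. 2 / q * \<bar>real (k_seq q (m_seq q n)) * q ^ m_seq q n - 1\<bar>) \<longlonglongrightarrow> 0"
      by simp
  qed
  then have "(\<lambda>n. SUP x. \<bar>measure P {\<omega> \<in> space P. a_seq \<beta> (m_seq q n) * (ar_max \<beta> \<epsilon> n \<omega> - 1) \<le> x}
      - H \<beta> (1 - p) x powr (p * r_seq q n)\<bar>) \<longlonglongrightarrow> 0"
    using assms q
    by (intro ar_max_uniform_limit[where R = "2 / q"] filterlim_m_seq r eventually_gt_at_top) auto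
  moreover have "(\<lambda>n. SUP x. \<bar>measure P {\<omega> \<in> space P. a_seq \<beta> n * (ar_max \<beta> \<epsilon> (k_seq q n) \<omega> - 1) \<le> x}
      - H \<beta> (1 - p) x powr (p * 1)\<bar>) \<longlonglongrightarrow> 0"
    using assms k k_seq_bounds(1)[OF q]
    by (intro ar_max_uniform_limit[where R = 1] filterlim_ident always_eventually allI)
      (auto simp: less_eq_Suc_le)
  ultimately show ?thesis
    using assms(5) by (simp add: a_circ_def)
qed

end
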